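(* Let $p\geq 11$. There exist geodesically antipodal, minimal pairs $((U,D),(V,\Lambda))\in M(p)\times M(p)$ such that each of $D$ and $\Lambda$ has pairwise distinct diagonal entries. Hence there exist $X,Y\in\mathrm{Sym}^+(p)$, each having $p$ distinct eigenvalues, for which the set $\mathcal{M}(X,Y)$ exhibits Type II non-uniqueness.
   Context: $\mathrm{Sym}^+(p)$ is the set of $p\times p$ real symmetric positive-definite matrices, $\mathrm{Diag}^+(p)$ the set of $p\times p$ diagonal matrices with positive diagonal entries, $M(p)=SO(p)\times \mathrm{Diag}^+(p)$, $F(U,D)=UDU^T$, and $\mathcal{E}_X=F^{-1}(X)$. (Points of $M(p)$ with $D$ having distinct entries, and matrices $X$ with distinct eigenvalues, constitute the top strata of $M(p)$ and $\mathrm{Sym}^+(p)$.) $SO(p)$ carries the bi-invariant Riemannian metric $g_{SO}$ given at the identity by $g_{SO}(A_1,A_2)=-\frac12\mathrm{tr}(A_1A_2)$; $\mathrm{Diag}^+(p)$ carries $g_{\mathcal{D}^+}|_D(L_1,L_2)=\mathrm{tr}(D^{-1}L_1D^{-1}L_2)$; $M(p)$ carries $g_M=k\,g_{SO}\oplus g_{\mathcal{D}^+}$ with fixed $k>0$ and distance $d_M$. The scaling-rotation distance is $d_{\mathcal{SR}}(X,Y)=\inf\{d_M(a,b):a\in\mathcal{E}_X,b\in\mathcal{E}_Y\}$. An $F$-minimal geodesic from $\mathcal{E}_X$ to $\mathcal{E}_Y$ is a geodesic $\gamma:[0,1]\to M(p)$ with $\gamma(0)\in\mathcal{E}_X$,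 $\gamma(1)\in\mathcal{E}_Y$ and length $d_{\mathcal{SR}}(X,Y)$. A minimal pair is a pair $(\gamma(0),\gamma(1))$ for such a $\gamma$ (for some $X,Y$). $\mathcal{M}(X,Y)$ is the set of minimal smooth scaling-rotation curves from $X$ to $Y$, i.e. curves $F\circ\gamma$ with $\gamma$ an $F$-minimal geodesic from $\mathcal{E}_X$ to $\mathcal{E}_Y$. A pair $((U,D),(V,\Lambda))\in M(p)\times M(p)$ is geodesically antipodal if $V^{-1}U$ is an involution ($R^2=I\ne R$; equivalently, $U$ and $V$ are in each other's cut-locus in $SO(p)$). $\mathcal{M}(X,Y)$ exhibits Type II non-uniqueness if there exist $F$-minimal geodesics $\gamma_1,\gamma_2$ from $\mathcal{E}_X$ to $\mathcal{E}_Y$ with $\gamma_1(0)=\gamma_2(0)$, $\gamma_1(1)=\gamma_2(1)$ and $F\circ\gamma_1\ne F\circ\gamma_2$. *)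

theory Defs
  imports "HOL-Analysis.Analysis"
begin

text \<open>
  A manifold is a subset \<open>M\<close> of a normed space; a Riemannian metric on it is a
  function \<open>g x v w\<close> of a base point and two tangent vectors, given by an expression that also
  makes sense (and is smooth) for points near \<open>M\<close> moving along \<open>M\<close>'s tangent directions.
\<close>

definition tangent_space :: "'a::real_normed_vector set \<Rightarrow> 'a \<Rightarrow> 'a set" where
  "tangent_space M x =
     {v. \<exists>c. c 0 = x \<and> (\<forall>\<^sub>F s in at (0::real). c s \<in> M) \<and> (c has_vector_derivative v) (at 0)}"

definition curve_speed ::
  "('a::real_normed_vector \<Rightarrow> 'a \<Rightarrow> 'a \<Rightarrow> real) \<Rightarrow> (real \<Rightarrow> 'a) \<Rightarrow> real \<Rightarrow> real" where
  "curve_speed g \<gamma> t = sqrt (g (\<gamma> t) (vector_derivative \<gamma> (at t)) (vector_derivative \<gamma> (at t)))"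

definition curve_length ::
  "('a::real_normed_vector \<Rightarrow> 'a \<Rightarrow> 'a \<Rightarrow> real) \<Rightarrow> (real \<Rightarrow> 'a) \<Rightarrow> real" where
  "curve_length g \<gamma> = integral {0..1} (curve_speed g \<gamma>)"

text \<open>
  \<open>piecewise_C1_differentiable_on\<close> allows the derivative to blow up at a breakpoint, and
  \<open>integral\<close> is 0 for a non-integrable function. Without the integrability condition, curves of
  infinite length would therefore be counted with length 0.
\<close>

definition riemannian_dist ::
  "'a::real_normed_vector set \<Rightarrow> ('a \<Rightarrow> 'a \<Rightarrow> 'a \<Rightarrow> real) \<Rightarrow> 'a \<Rightarrow> 'a \<Rightarrow> real" where
  "riemannian_dist M g a b =
     Inf {curve_length g \<gamma> | \<gamma>. \<gamma> piecewise_C1_differentiable_on {0..1} \<and> \<gamma> ` {0..1} \<subseteq> M \<and>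
            \<gamma> 0 = a \<and> \<gamma> 1 = b \<and> curve_speed g \<gamma> integrable_on {0..1}}"

text \<open>
  The geodesic equation \<open>\<nabla>\<^bsub>\<gamma>'\<^esub> \<gamma>' = 0\<close> with the index lowered: for every tangent vector \<open>v\<close>
  at \<open>\<gamma> t\<close>,
  \<open>g (\<nabla>\<^bsub>\<gamma>'\<^esub> \<gamma>', v) = d/dt g\<^bsub>\<gamma>\<^esub>(\<gamma>', v) - 1/2 * \<partial>\<^sub>v g(\<gamma>', \<gamma>')\<close>,
  where in the first term \<open>v\<close> and in the second term \<open>\<gamma>' t\<close> are held constant. In a chart this
  is the usual formula with Christoffel symbols of the first kind. It is the Euler-Lagrange
  expression of the energy density \<open>1/2 * g(\<gamma>', \<gamma>')\<close>, hence compatible with the inclusion of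
  \<open>M\<close> into the ambient space and independent of how \<open>g\<close> extends off \<open>M\<close>.
\<close>

definition riemannian_geodesic ::
  "'a::real_normed_vector set \<Rightarrow> ('a \<Rightarrow> 'a \<Rightarrow> 'a \<Rightarrow> real) \<Rightarrow> (real \<Rightarrow> 'a) \<Rightarrow> bool" where
  "riemannian_geodesic M g \<gamma> \<longleftrightarrow>
     (\<exists>\<gamma>1 \<gamma>2. \<forall>t\<in>{0..1}.
        \<gamma> t \<in> M \<and>
        (\<gamma> has_vector_derivative \<gamma>1 t) (at t within {0..1}) \<and>
        (\<gamma>1 has_vector_derivative \<gamma>2 t) (at t within {0..1}) \<and>
        (\<forall>v\<in>tangent_space M (\<gamma> t). \<exists>a b.
           ((\<lambda>s. g (\<gamma> s) (\<gamma>1 s) v) has_real_derivative a) (at t within {0..1}) \<and>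
           ((\<lambda>s. g (\<gamma> t + s *\<^sub>R v) (\<gamma>1 t) (\<gamma>1 t)) has_real_derivative b) (at 0) \<and>
           a - 1/2 * b = 0))"

text \<open>The matrix size \<open>p\<close> is \<open>CARD('n)\<close>.\<close>

definition Sym_plus :: "(real^'n^'n) set" where
  "Sym_plus = {X. transpose X = X \<and> (\<forall>v. v \<noteq> 0 \<longrightarrow> v \<bullet> (X *v v) > 0)}"

definition Diag_plus :: "(real^'n^'n) set" where
  "Diag_plus = {D. (\<forall>i j. i \<noteq> j \<longrightarrow> D $ i $ j = 0) \<and> (\<forall>i. D $ i $ i > 0)}"

definition SO :: "(real^'n^'n) set" where
  "SO = {U. rotation_matrix U}"

definition M_space :: "((real^'n^'n) \<times> (real^'n^'n)) set" where
  "M_space = SO \<times> Diag_plus"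

definition F_map :: "(real^'n^'n) \<times> (real^'n^'n) \<Rightarrow> real^'n^'n" where
  "F_map = (\<lambda>(U, D). U ** D ** transpose U)"

definition fibre :: "real^'n^'n \<Rightarrow> ((real^'n^'n) \<times> (real^'n^'n)) set" where
  "fibre X = {a \<in> M_space. F_map a = X}"

text \<open>Left translation to the identity, using \<open>U\<^sup>-\<^sup>1 = U\<^sup>T\<close> on \<open>SO(p)\<close>.\<close>

definition g_SO :: "real^'n^'n \<Rightarrow> real^'n^'n \<Rightarrow> real^'n^'n \<Rightarrow> real" where
  "g_SO U A1 A2 = - 1/2 * trace ((transpose U ** A1) ** (transpose U ** A2))"

definition g_Diag :: "real^'n^'n \<Rightarrow> real^'n^'n \<Rightarrow> real^'n^'n \<Rightarrow> real" where
  "g_Diag D L1 L2 = trace (matrix_inv D ** L1 ** matrix_inv D ** L2)"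

definition g_M :: "real \<Rightarrow> (real^'n^'n) \<times> (real^'n^'n) \<Rightarrow> (real^'n^'n) \<times> (real^'n^'n) \<Rightarrow>
    (real^'n^'n) \<times> (real^'n^'n) \<Rightarrow> real" where
  "g_M k = (\<lambda>(U, D) (A1, L1) (A2, L2). k * g_SO U A1 A2 + g_Diag D L1 L2)"

definition d_M :: "real \<Rightarrow> (real^'n^'n) \<times> (real^'n^'n) \<Rightarrow> (real^'n^'n) \<times> (real^'n^'n) \<Rightarrow> real" where
  "d_M k = riemannian_dist M_space (g_M k)"

definition d_SR :: "real \<Rightarrow> real^'n^'n \<Rightarrow> real^'n^'n \<Rightarrow> real" where
  "d_SR k X Y = Inf {d_M k a b | a b. a \<in> fibre X \<and> b \<in> fibre Y}"

definition F_minimal_geodesic ::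
  "real \<Rightarrow> real^'n^'n \<Rightarrow> real^'n^'n \<Rightarrow> (real \<Rightarrow> (real^'n^'n) \<times> (real^'n^'n)) \<Rightarrow> bool" where
  "F_minimal_geodesic k X Y \<gamma> \<longleftrightarrow>
     riemannian_geodesic M_space (g_M k) \<gamma> \<and> \<gamma> 0 \<in> fibre X \<and> \<gamma> 1 \<in> fibre Y \<and>
     curve_length (g_M k) \<gamma> = d_SR k X Y"

definition minimal_pair ::
  "real \<Rightarrow> (real^'n^'n) \<times> (real^'n^'n) \<Rightarrow> (real^'n^'n) \<times> (real^'n^'n) \<Rightarrow> bool" where
  "minimal_pair k a b \<longleftrightarrow>
     (\<exists>X\<in>Sym_plus. \<exists>Y\<in>Sym_plus. \<exists>\<gamma>. F_minimal_geodesic k X Y \<gamma> \<and> \<gamma> 0 = a \<and> \<gamma> 1 = b)"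

text \<open>
  Curves are functions on \<open>[0,1]\<close>, so values outside the interval are discarded before curves are
  compared.
\<close>

definition sr_curve ::
  "(real \<Rightarrow> (real^'n^'n) \<times> (real^'n^'n)) \<Rightarrow> real \<Rightarrow> real^'n^'n" where
  "sr_curve \<gamma> = restrict (F_map \<circ> \<gamma>) {0..1}"

text \<open>Type II non-uniqueness of the set of minimal smooth scaling-rotation curves from \<open>X\<close> to \<open>Y\<close>.\<close>

definition type_II_nonunique :: "real \<Rightarrow> real^'n^'n \<Rightarrow> real^'n^'n \<Rightarrow> bool" where
  "type_II_nonunique k X Y \<longleftrightarrow>
     (\<exists>\<gamma>1 \<gamma>2. F_minimal_geodesic k X Y \<gamma>1 \<and> F_minimal_geodesic k X Y \<gamma>2 \<and>
        \<gamma>1 0 = \<gamma>2 0 \<and> \<gamma>1 1 = \<gamma>2 1 \<and> sr_curve \<gamma>1 \<noteq> sr_curve \<gamma>2)"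

definition involution :: "real^'n^'n \<Rightarrow> bool" where
  "involution R \<longleftrightarrow> R ** R = mat 1 \<and> R \<noteq> mat 1"

definition geodesically_antipodal ::
  "(real^'n^'n) \<times> (real^'n^'n) \<Rightarrow> (real^'n^'n) \<times> (real^'n^'n) \<Rightarrow> bool" where
  "geodesically_antipodal = (\<lambda>(U, D) (V, \<Lambda>). involution (matrix_inv V ** U))"

definition distinct_diagonal :: "real^'n^'n \<Rightarrow> bool" where
  "distinct_diagonal D \<longleftrightarrow> inj (\<lambda>i. D $ i $ i)"

definition eigenvalues :: "real^'n^'n \<Rightarrow> real set" where
  "eigenvalues X = {c. \<exists>v. v \<noteq> 0 \<and> X *v v = c *s v}"

end

theory Submission
  imports Defs
begin

text \<open>
  Let \<open>D\<close> be diagonal with distinct positive entries and let \<open>R = 1 - 2 P\<close> be the half turn in a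
  plane \<open>E\<close> with orthogonal projection \<open>P\<close>. Turning in \<open>E\<close> by the angle \<open>\<pi>\<close> in one sense or the
  other gives two geodesics of length \<open>sqrt k * \<pi>\<close> from \<open>(1, D)\<close> to \<open>(R, D)\<close>. All claims
  follow once no curve between the fibres of \<open>X = D\<close> and \<open>Y = R D R\<^sup>T\<close> is shorter: \<open>R\<close> is an
  involution, and the two images in \<open>Sym\<^sup>+(p)\<close> differ at time \<open>1/2\<close> unless \<open>P\<close> commutes with \<open>D\<close>,
  that is, unless \<open>P\<close> is diagonal (\<open>quarter_turns_conjugate_eqD\<close>).

  The points of the two fibres differ from \<open>(1, D)\<close> and \<open>(R, D)\<close> by signed permutations. The
  entries of \<open>D\<close> are chosen so far apart on the logarithmic scale that a curve exchanging
  eigenvalues is too long (\<open>length_ge_log_ratio\<close>). Only changes of signs remain, and \<open>R\<close> must be no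
  closer to a diagonal sign matrix \<open>S\<close> of determinant \<open>1\<close> than to the identity.

  If \<open>S\<close> negates the coordinates in \<open>J\<close>, the rotation angles of \<open>S R\<close> are twice the principal
  angles between \<open>E\<close> and the coordinate subspace of \<open>J\<close>, and half turns when the dimensions differ.
  The critical case is \<open>card J = 2\<close>, where the two principal angles must satisfy
  \<open>\<phi>\<^sub>1\<^sup>2 + \<phi>\<^sub>2\<^sup>2 \<ge> \<pi>\<^sup>2 / 4\<close>. Here the dimension enters: \<open>E\<close> must be spread over
  enough coordinates. Let \<open>E\<close> be spanned by the indicator vectors of disjoint sets \<open>A\<close> of size 6 and
  \<open>B\<close> of size 5. If \<open>J\<close> has a point outside both sets, or two points in one of them, or is empty, some
  nonzero vector is reversed by \<open>S R\<close> and its path on the sphere has length at least \<open>\<pi>\<close>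
  (\<open>length_ge_vector_angle\<close>). Otherwise \<open>J\<close> has one point in each, the principal angles have
  cosines \<open>1 / sqrt 6\<close> and \<open>1 / sqrt 5\<close>, and \<open>\<phi>\<^sub>1\<^sup>2 + \<phi>\<^sub>2\<^sup>2\<close> is about \<open>2.549\<close>, above
  \<open>\<pi>\<^sup>2 / 4 \<approx> 2.467\<close>. For this case the proof avoids the distance formula on \<open>SO(p)\<close>: a frame of four
  vectors is a point on a sphere of radius \<open>2\<close>, and because the two angles are nearly equal, its path
  there already gives the bound (\<open>length_ge_frame_angle\<close>, \<open>length_ge_pi_half_turn\<close>).

  Since distances are infima over curves, the lower bounds on lengths give lower bounds on distances
  only if any two points of \<open>M(p)\<close> are joined by a curve of finite length; this is the connectedness of
  \<open>SO(p)\<close> (\<open>SO_C1_connected\<close>).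
\<close>

section \<open>Matrices as a Euclidean space\<close>

lemma matrix_product_bounded_bilinear:
  "bounded_bilinear ((**) :: real^'n^'n \<Rightarrow> real^'n^'n \<Rightarrow> real^'n^'n)"
  unfolding bilinear_conv_bounded_bilinear[symmetric] bilinear_def
  by (auto intro!: linearI
      simp: matrix_matrix_mult_def vec_eq_iff sum.distrib sum_distrib_left algebra_simps)

lemmas matrix_product_simps =
  bounded_bilinear.add_left[OF matrix_product_bounded_bilinear]
  bounded_bilinear.add_right[OF matrix_product_bounded_bilinear]
  bounded_bilinear.diff_left[OF matrix_product_bounded_bilinear]
  bounded_bilinear.diff_right[OF matrix_product_bounded_bilinear]
  bounded_bilinear.minus_left[OF matrix_product_bounded_bilinear]
  bounded_bilinear.minus_right[OF matrix_product_bounded_bilinear]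
  bounded_bilinear.scaleR_left[OF matrix_product_bounded_bilinear]
  bounded_bilinear.scaleR_right[OF matrix_product_bounded_bilinear]

lemmas has_vector_derivative_matrix_product =
  bounded_bilinear.has_vector_derivative[OF matrix_product_bounded_bilinear]

lemmas continuous_on_matrix_product [continuous_intros] =
  bounded_bilinear.continuous_on[OF matrix_product_bounded_bilinear]

lemma transpose_bounded_linear: "bounded_linear (transpose :: real^'n^'n \<Rightarrow> real^'n^'n)"
  by (rule linear_conv_bounded_linear[THEN iffD1], rule linearI)
     (auto simp: transpose_def vec_eq_iff)

lemmas transpose_simps =
  linear_add[OF bounded_linear.linear[OF transpose_bounded_linear]]
  linear_diff[OF bounded_linear.linear[OF transpose_bounded_linear]]
  linear_neg[OF bounded_linear.linear[OF transpose_bounded_linear]]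
  linear_cmul[OF bounded_linear.linear[OF transpose_bounded_linear]]

lemma trace_bounded_linear: "bounded_linear (trace :: real^'n^'n \<Rightarrow> real)"
  by (rule linear_conv_bounded_linear[THEN iffD1], rule linearI)
     (auto simp: trace_def sum.distrib sum_distrib_left)

lemmas trace_simps =
  linear_add[OF bounded_linear.linear[OF trace_bounded_linear]]
  linear_diff[OF bounded_linear.linear[OF trace_bounded_linear]]
  linear_neg[OF bounded_linear.linear[OF trace_bounded_linear]]
  linear_cmul[OF bounded_linear.linear[OF trace_bounded_linear]]

lemma matrix_vector_bounded_linear: "bounded_linear (\<lambda>A :: real^'n^'n. A *v x)"
  by (rule linear_conv_bounded_linear[THEN iffD1], rule linearI)
     (auto simp: matrix_vector_mult_add_rdistrib scaleR_matrix_vector_assoc)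

lemma trace_transpose: "trace (transpose A) = trace A"
  by (simp add: trace_def transpose_def)

lemma trace_transpose_mult_eq_inner:
  fixes A B :: "real^'n^'n"
  shows "trace (transpose A ** B) = inner A B"
  unfolding trace_def transpose_def matrix_matrix_mult_def inner_vec_def
  by (simp, subst sum.swap, simp)

text \<open>
  Tangent vectors of \<open>SO(p)\<close> are skew after left translation. Pairing them with a symmetric matrix
  gives zero, which is what makes the geodesic equation of a plane rotation hold.
\<close>

lemma trace_symmetric_mult_skew:
  fixes P A :: "real^'n^'n"
  assumes "transpose P = P" "transpose A = - A"
  shows "trace (P ** A) = 0"
proof -
  have "trace (P ** A) = trace (transpose (P ** A))" by (simp add: trace_transpose)
  also have "\<dots> = - trace (A ** P)"
    by (simp add: matrix_transpose_mul assms matrix_product_simps trace_simps)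
  also have "trace (A ** P) = trace (P ** A)" by (rule trace_mul_sym)
  finally show ?thesis by simp
qed

lemma inner_matrix_vector_transpose:
  fixes A :: "real^'n^'n"
  shows "inner (A *v x) y = inner x (transpose A *v y)"
  by (metis dot_lmul_matrix inner_commute transpose_matrix_vector transpose_transpose)

lemma orthogonal_matrix_inner:
  fixes U :: "real^'n^'n"
  assumes "orthogonal_matrix U"
  shows "inner (U *v x) (U *v y) = inner x y"
  using assms
  by (simp add: inner_matrix_vector_transpose matrix_vector_mul_assoc orthogonal_matrix_def
      del: transpose_matrix_vector)

lemma orthogonal_matrix_norm:
  fixes U :: "real^'n^'n"
  assumes "orthogonal_matrix U"
  shows "norm (U *v x) = norm x"
  by (simp add: norm_eq_sqrt_inner orthogonal_matrix_inner[OF assms])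

lemma norm_orthogonal_mult:
  fixes U A :: "real^'n^'n"
  assumes "orthogonal_matrix U"
  shows "norm (U ** A) = norm A"
proof -
  have "inner (U ** A) (U ** A) = inner A A"
    unfolding trace_transpose_mult_eq_inner[symmetric] matrix_transpose_mul
    by (metis assms matrix_mul_assoc matrix_mul_lid orthogonal_matrix_def)
  thus ?thesis by (simp add: norm_eq_sqrt_inner)
qed

subsection \<open>Rank-one matrices and orthonormal frames\<close>

definition outer :: "real^'n \<Rightarrow> real^'n \<Rightarrow> real^'n^'n" where
  "outer a b = (\<chi> i j. a $ i * b $ j)"

lemma transpose_outer [simp]: "transpose (outer a b) = outer b a"
  by (simp add: outer_def transpose_def vec_eq_iff)

lemma outer_mult_outer [simp]: "outer a b ** outer c d = inner b c *\<^sub>R outer a d"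
  by (simp add: outer_def matrix_matrix_mult_def vec_eq_iff inner_vec_def sum_distrib_left
      sum_distrib_right mult_ac)

lemma outer_mult_vector [simp]: "outer a b *v x = inner b x *\<^sub>R a"
  by (simp add: outer_def matrix_vector_mult_def vec_eq_iff inner_vec_def sum_distrib_left
      mult_ac)

lemma matrix_mult_outer: "A ** outer a b = outer (A *v a) b"
  by (simp add: outer_def matrix_matrix_mult_def matrix_vector_mult_def vec_eq_iff
      sum_distrib_left sum_distrib_right mult_ac)

lemma inner_outer_right: "inner A (outer a b) = inner (A *v b) a"
  by (simp add: outer_def inner_vec_def matrix_vector_mult_def sum_distrib_left
      sum_distrib_right mult_ac)

definition orthonormal_family :: "'i set \<Rightarrow> ('i \<Rightarrow> real^'n) \<Rightarrow> bool" where
  "orthonormal_family I x \<longleftrightarrow> (\<forall>l\<in>I. \<forall>m\<in>I. inner (x l) (x m) = (if l = m then 1 else 0))"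

definition span_projection :: "'i set \<Rightarrow> ('i \<Rightarrow> real^'n) \<Rightarrow> real^'n^'n" where
  "span_projection I x = (\<Sum>l\<in>I. outer (x l) (x l))"

lemma mult_span_projection: "A ** span_projection I x = (\<Sum>l\<in>I. outer (A *v x l) (x l))"
proof (induction I rule: infinite_finite_induct)
  case (insert l I)
  then show ?case
    by (simp add: span_projection_def matrix_product_simps matrix_mult_outer)
qed (simp_all add: span_projection_def)

lemma inner_mult_span_projection:
  fixes A B :: "real^'n^'n"
  assumes "finite I" "orthonormal_family I x"
  shows "inner (A ** span_projection I x) (B ** span_projection I x)
       = (\<Sum>l\<in>I. inner (A *v x l) (B *v x l))"
proof -
  have outer_inner: "inner (outer a b) (outer c d) = inner a c * inner b d"
    for a b c d :: "real^'n"
    by (simp add: inner_outer_right mult.commute)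
  have "inner (A ** span_projection I x) (B ** span_projection I x)
      = (\<Sum>l\<in>I. \<Sum>m\<in>I. inner (A *v x l) (B *v x m) * inner (x l) (x m))"
    by (subst sum.swap)
       (simp add: mult_span_projection inner_sum_left inner_sum_right outer_inner)
  also have "\<dots> = (\<Sum>l\<in>I. \<Sum>m\<in>I. if l = m then inner (A *v x l) (B *v x m) else 0)"
    using assms(2) by (intro sum.cong refl) (simp add: orthonormal_family_def)
  also have "\<dots> = (\<Sum>l\<in>I. inner (A *v x l) (B *v x l))"
    using assms(1) by simp
  finally show ?thesis .
qed

text \<open>
  Bessel's inequality, applied to all rows of \<open>A\<close> at once: the right multiplication with the
  projection projects each row.
\<close>

lemma norm_mult_span_projection_le:
  fixes A :: "real^'n^'n"
  assumes "finite I" "orthonormal_family I x"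
  shows "norm (A ** span_projection I x) \<le> norm A"
proof -
  define s where "s = (\<Sum>l\<in>I. inner (A *v x l) (A *v x l))"
  have cross: "inner A (A ** span_projection I x) = s"
    by (simp add: mult_span_projection inner_sum_right inner_outer_right s_def)
  have square: "inner (A ** span_projection I x) (A ** span_projection I x) = s"
    unfolding s_def by (rule inner_mult_span_projection[OF assms])
  have "0 \<le> inner (A - A ** span_projection I x) (A - A ** span_projection I x)" by simp
  also have "\<dots> = inner A A - s"
    by (simp add: inner_diff_left inner_diff_right cross square inner_commute)
  finally show ?thesis by (simp add: norm_le square)
qed

text \<open>
  A skew matrix acts with the same strength on a second direction, the image of \<open>x\<close>. This gains
  the factor \<open>sqrt 2\<close> over the general bound by the Frobenius norm.
\<close>

lemma norm_skew_mult_vector_le: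
  fixes A :: "real^'n^'n"
  assumes skew: "transpose A = - A"
  shows "norm (A *v x) \<le> norm A * norm x / sqrt 2"
proof (cases "A *v x = 0")
  case True
  thus ?thesis by simp
next
  case False
  hence "x \<noteq> 0" by auto
  define e where "e = x /\<^sub>R norm x"
  define y where "y = (A *v e) /\<^sub>R norm (A *v e)"
  have ne: "norm e = 1" using \<open>x \<noteq> 0\<close> by (simp add: e_def)
  have Ae: "A *v e = (A *v x) /\<^sub>R norm x"
    by (simp add: e_def matrix_vector_mult_scaleR)
  hence Ae0: "A *v e \<noteq> 0" using False \<open>x \<noteq> 0\<close> by simp
  have skew_inner: "inner (A *v u) v = - inner u (A *v v)" for u v :: "real^'n"
    by (simp add: inner_matrix_vector_transpose skew
        linear_neg[OF bounded_linear.linear[OF matrix_vector_bounded_linear]]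
        del: transpose_matrix_vector)
  have "inner e (A *v e) = 0" using skew_inner[of e e] by (simp add: inner_commute)
  hence ey: "inner e y = 0" by (simp add: y_def)
  have ny: "norm y = 1" using Ae0 by (simp add: y_def)
  define f where "f = (\<lambda>b. if b then e else y)"
  have on: "orthonormal_family UNIV f"
    using ey ne ny by (auto simp: orthonormal_family_def f_def inner_commute norm_eq_1)
  have "inner (A *v e) y = norm (A *v e)"
    using Ae0 by (simp add: y_def power2_norm_eq_inner[symmetric] power2_eq_square)
  hence "norm (A *v e) = \<bar>inner e (A *v y)\<bar>"
    using skew_inner[of e y] by (metis abs_minus_cancel abs_norm_cancel)
  also have "\<dots> \<le> norm (A *v y)"
    using Cauchy_Schwarz_ineq2[of e "A *v y"] ne by simp
  finally have "2 * (norm (A *v e))\<^sup>2 \<le> (norm (A *v e))\<^sup>2 + (norm (A *v y))\<^sup>2" by simp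
  also have "\<dots> = (norm (A ** span_projection UNIV f))\<^sup>2"
    using inner_mult_span_projection[OF _ on, of A A]
    by (simp add: power2_norm_eq_inner f_def UNIV_bool)
  also have "\<dots> \<le> (norm A)\<^sup>2"
    by (intro power_mono norm_mult_span_projection_le[OF _ on]) auto
  finally have "(sqrt 2 * norm (A *v e))\<^sup>2 \<le> (norm A)\<^sup>2"
    by (simp only: power_mult_distrib real_sqrt_pow2)
  hence "sqrt 2 * norm (A *v e) \<le> norm A"
    by (rule power2_le_imp_le) simp
  moreover have "norm (A *v x) = norm x * norm (A *v e)"
    using \<open>x \<noteq> 0\<close> by (simp add: Ae)
  ultimately show ?thesis
    using mult_left_mono[of "sqrt 2 * norm (A *v e)" "norm A" "norm x"]
    by (simp add: pos_le_divide_eq mult_ac)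
qed

subsection \<open>Diagonal matrices\<close>

definition diag_matrix :: "('n \<Rightarrow> real) \<Rightarrow> real^'n^'n" where
  "diag_matrix f = (\<chi> i j. if i = j then f i else 0)"

lemma diag_matrix_nth [simp]: "diag_matrix f $ i $ j = (if i = j then f i else 0)"
  by (simp add: diag_matrix_def)

lemma diag_matrix_eq_iff [simp]: "diag_matrix f = diag_matrix g \<longleftrightarrow> f = g"
  by (auto simp: vec_eq_iff fun_eq_iff)

lemma eq_diag_matrix: "(\<And>i j. i \<noteq> j \<Longrightarrow> A $ i $ j = 0) \<Longrightarrow> A = diag_matrix (\<lambda>i. A $ i $ i)"
  by (auto simp: vec_eq_iff)

lemma diag_matrix_1: "diag_matrix (\<lambda>_. 1) = mat 1"
  by (simp add: vec_eq_iff mat_def)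

lemma transpose_diag_matrix [simp]: "transpose (diag_matrix f) = diag_matrix f"
  by (auto simp: transpose_def vec_eq_iff)

lemma diag_matrix_vector: "(diag_matrix f *v x) $ i = f i * x $ i"
  by (simp add: matrix_vector_mult_def if_distrib if_distribR cong: if_cong)

lemma diag_matrix_mult_nth: "(diag_matrix f ** A) $ i $ j = f i * A $ i $ j"
  by (simp add: matrix_matrix_mult_def if_distrib if_distribR cong: if_cong)

lemma mult_diag_matrix_nth: "(A ** diag_matrix f) $ i $ j = A $ i $ j * f j"
  by (simp add: matrix_matrix_mult_def if_distrib if_distribR cong: if_cong)

lemma diag_matrix_mult [simp]: "diag_matrix f ** diag_matrix g = diag_matrix (\<lambda>i. f i * g i)"
  by (simp add: vec_eq_iff mult_diag_matrix_nth)

lemma trace_diag_matrix [simp]: "trace (diag_matrix f) = (\<Sum>i\<in>UNIV. f i)"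
  by (simp add: trace_def)

lemma det_diag_matrix [simp]: "det (diag_matrix f) = (\<Prod>i\<in>UNIV. f i)"
  by (subst det_diagonal) auto

lemma matrix_inv_eqI:
  fixes A B :: "real^'n^'n"
  assumes "A ** B = mat 1"
  shows "matrix_inv A = B"
proof -
  have BA: "B ** A = mat 1" using assms matrix_left_right_inverse by blast
  have "\<exists>A'. A ** A' = mat 1 \<and> A' ** A = mat 1" using assms BA by blast
  hence "A ** matrix_inv A = mat 1"
    unfolding matrix_inv_def by (rule someI2_ex) simp
  hence "(B ** A) ** matrix_inv A = B"
    by (simp add: matrix_mul_assoc[symmetric])
  thus ?thesis by (simp add: BA)
qed

lemma matrix_inv_diag_matrix:
  assumes "\<And>i. f i \<noteq> 0"
  shows "matrix_inv (diag_matrix f) = diag_matrix (\<lambda>i. 1 / f i)"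
  by (rule matrix_inv_eqI) (simp add: assms diag_matrix_1)

lemma matrix_inv_orthogonal:
  fixes U :: "real^'n^'n"
  shows "orthogonal_matrix U \<Longrightarrow> matrix_inv U = transpose U"
  by (rule matrix_inv_eqI) (simp add: orthogonal_matrix_def)

lemma Diag_plus_iff: "D \<in> Diag_plus \<longleftrightarrow> (\<exists>f. (\<forall>i. f i > 0) \<and> D = diag_matrix f)"
proof
  assume "D \<in> Diag_plus"
  hence "\<forall>i. D $ i $ i > 0" "D = diag_matrix (\<lambda>i. D $ i $ i)"
    by (auto simp: Diag_plus_def intro!: eq_diag_matrix)
  thus "\<exists>f. (\<forall>i. f i > 0) \<and> D = diag_matrix f"
    by (intro exI[of _ "\<lambda>i. D $ i $ i"]) (rule conjI)
next
  assume "\<exists>f. (\<forall>i. f i > 0) \<and> D = diag_matrix f"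
  then obtain f where "\<forall>i. f i > 0" "D = diag_matrix f" by blast
  thus "D \<in> Diag_plus" by (simp add: Diag_plus_def)
qed

section \<open>Lengths of curves: lower bounds by calibration\<close>

lemma integral_ge_increment:
  fixes \<phi> f :: "real \<Rightarrow> real"
  assumes "finite S" "continuous_on {0..1} \<phi>" "f integrable_on {0..1}"
    and der: "\<And>t. t \<in> {0<..<1} - S \<Longrightarrow> (\<phi> has_real_derivative \<phi>' t) (at t)"
    and le: "\<And>t. t \<in> {0<..<1} - S \<Longrightarrow> \<phi>' t \<le> f t"
  shows "\<phi> 1 - \<phi> 0 \<le> integral {0..1} f"
proof -
  have "(\<phi>' has_integral (\<phi> 1 - \<phi> 0)) {0..1}"
    using assms(1,2) der
    by (intro fundamental_theorem_of_calculus_interior_strong[of S])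
       (auto simp: has_real_derivative_iff_has_vector_derivative)
  hence "((\<lambda>t. if t \<in> S \<union> {0, 1} then f t else \<phi>' t) has_integral (\<phi> 1 - \<phi> 0)) {0..1}"
    by (rule has_integral_spike_finite[rotated 2, of _ _ _ "S \<union> {0, 1}"]) (auto simp: assms(1))
  moreover have "(f has_integral integral {0..1} f) {0..1}"
    using assms(3) by (rule integrable_integral)
  ultimately show ?thesis
    by (rule has_integral_le) (use le in auto)
qed

text \<open>
  The angle to the starting point is a 1-Lipschitz function on the unit sphere, but it is not
  differentiable at the starting point and at its antipode. Shrinking the cosine by a
  factor \<open>q < 1\<close> keeps the angle away from \<open>0\<close> and \<open>\<pi>\<close> without increasing its derivative; the
  bound then follows as \<open>q\<close> tends to \<open>1\<close>.
\<close>

lemma unit_sphere_curve_angle_le: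
  fixes c c' :: "real \<Rightarrow> 'a::real_inner"
  assumes "finite S" and cont: "continuous_on {0..1} c" and int: "f integrable_on {0..1}"
    and der: "\<And>t. t \<in> {0<..<1} - S \<Longrightarrow> (c has_vector_derivative c' t) (at t)"
    and speed: "\<And>t. t \<in> {0<..<1} - S \<Longrightarrow> norm (c' t) \<le> f t"
    and unit: "\<And>t. t \<in> {0..1} \<Longrightarrow> norm (c t) = 1"
  shows "arccos (inner (c 0) (c 1)) \<le> integral {0..1} f"
proof -
  define h where "h t = inner (c 0) (c t)" for t
  define h' where "h' t = inner (c 0) (c' t)" for t
  have h_le: "\<bar>h t\<bar> \<le> 1" if "t \<in> {0..1}" for t
    using Cauchy_Schwarz_ineq2[of "c 0" "c t"] unit[of 0] unit[OF that] by (simp add: h_def)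
  have h0: "h 0 = 1" using unit[of 0] by (simp add: h_def norm_eq_1)
  have der_h: "(h has_real_derivative h' t) (at t)" if "t \<in> {0<..<1} - S" for t
    unfolding h_def h'_def has_real_derivative_iff_has_vector_derivative
    using bounded_linear.has_vector_derivative[OF bounded_linear_inner_right der[OF that]] .
  have orth: "inner (c t) (c' t) = 0" if t: "t \<in> {0<..<1} - S" for t
  proof -
    have "((\<lambda>s. inner (c s) (c s)) has_vector_derivative
        (inner (c t) (c' t) + inner (c' t) (c t))) (at t)"
      by (rule bounded_bilinear.has_vector_derivative[OF bounded_bilinear_inner der[OF t] der[OF t]])
    moreover have "((\<lambda>s. inner (c s) (c s)) has_vector_derivative 0) (at t)"
    proof (rule has_vector_derivative_transform_within_open[where S = "{0<..<1}"])
      show "((\<lambda>s. 1) has_vector_derivative 0) (at t)" by simp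
      show "1 = inner (c s) (c s)" if "s \<in> {0<..<1}" for s
        using unit[of s] that by (simp add: norm_eq_1)
    qed (use t in auto)
    ultimately show ?thesis
      using vector_derivative_unique_at by (fastforce simp: inner_commute)
  qed
  have h'_le: "(h' t)\<^sup>2 \<le> (f t)\<^sup>2 * (1 - (h t)\<^sup>2)" if t: "t \<in> {0<..<1} - S" for t
  proof -
    define d where "d = c 0 - h t *\<^sub>R c t"
    have "h' t = inner d (c' t)"
      by (simp add: h'_def d_def inner_diff_left orth[OF t])
    moreover have "(inner d (c' t))\<^sup>2 \<le> inner d d * inner (c' t) (c' t)"
      by (rule Cauchy_Schwarz_ineq)
    moreover have "inner d d = 1 - (h t)\<^sup>2"
    proof -
      have "inner (c 0) (c 0) = 1" "inner (c t) (c t) = 1"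
        using unit[of 0] unit[of t] t by (auto simp: norm_eq_1)
      thus ?thesis
        by (simp add: d_def inner_diff_left inner_diff_right h_def inner_commute
            power2_eq_square)
    qed
    moreover have "inner (c' t) (c' t) \<le> (f t)\<^sup>2"
      using speed[OF t] by (simp add: power2_norm_eq_inner[symmetric] power_mono)
    moreover have "0 \<le> 1 - (h t)\<^sup>2"
      using h_le[of t] t abs_square_le_1[of "h t"] by auto
    ultimately show ?thesis
      using mult_left_mono[of "inner (c' t) (c' t)" "(f t)\<^sup>2" "1 - (h t)\<^sup>2"]
      by (simp add: mult.commute)
  qed
  have shrunk: "arccos (q * h 1) - arccos (q * h 0) \<le> integral {0..1} f"
    if q: "0 < q" "q < 1" for q
  proof (rule integral_ge_increment[OF assms(1) _ int])
    have bd: "\<bar>q * h t\<bar> < 1" if "t \<in> {0..1}" for t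
    proof -
      have "\<bar>q * h t\<bar> \<le> q * 1"
        using h_le[OF that] q by (simp add: abs_mult)
      thus ?thesis using q by simp
    qed
    have bd': "- 1 < q * h t" "q * h t < 1" if "t \<in> {0..1}" for t
      using bd[OF that] by (auto simp: abs_less_iff)
    show "continuous_on {0..1} (\<lambda>t. arccos (q * h t))"
      unfolding h_def
      by (intro continuous_on_arccos continuous_intros cont)
         (use bd' in \<open>force simp: h_def intro: less_imp_le\<close>)
    show "((\<lambda>t. arccos (q * h t)) has_real_derivative
        (inverse (- sqrt (1 - (q * h t)\<^sup>2)) * (q * h' t))) (at t)"
      if t: "t \<in> {0<..<1} - S" for t
    proof (rule DERIV_chain2[where f = arccos])
      show "(arccos has_real_derivative inverse (- sqrt (1 - (q * h t)\<^sup>2))) (at (q * h t))"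
        using bd'[of t] t by (intro DERIV_arccos) auto
      show "((\<lambda>t. q * h t) has_real_derivative q * h' t) (at t)"
        by (intro DERIV_cmult der_h t)
    qed
    show "inverse (- sqrt (1 - (q * h t)\<^sup>2)) * (q * h' t) \<le> f t"
      if t: "t \<in> {0<..<1} - S" for t
    proof -
      have f0: "0 \<le> f t" using speed[OF t] norm_ge_zero order_trans by blast
      have pos: "0 < 1 - (q * h t)\<^sup>2"
        using bd[of t] t abs_square_less_1[of "q * h t"] by auto
      have "(q * h' t)\<^sup>2 \<le> q\<^sup>2 * ((f t)\<^sup>2 * (1 - (h t)\<^sup>2))"
        using h'_le[OF t] by (simp add: power_mult_distrib mult_left_mono)
      also have "\<dots> = (f t)\<^sup>2 * (q\<^sup>2 - (q * h t)\<^sup>2)"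
        by (simp add: algebra_simps power_mult_distrib)
      also have "\<dots> \<le> (f t)\<^sup>2 * (1 - (q * h t)\<^sup>2)"
        using q by (intro mult_left_mono) (auto simp: power_le_one)
      also have "\<dots> = (f t * sqrt (1 - (q * h t)\<^sup>2))\<^sup>2"
        using pos by (simp add: power_mult_distrib)
      finally have "\<bar>q * h' t\<bar> \<le> f t * sqrt (1 - (q * h t)\<^sup>2)"
        using f0 pos by (simp add: abs_le_square_iff[symmetric])
      hence "- (q * h' t) \<le> f t * sqrt (1 - (q * h t)\<^sup>2)" by linarith
      hence "- (q * h' t) / sqrt (1 - (q * h t)\<^sup>2) \<le> f t"
        using pos by (subst pos_divide_le_eq) auto
      thus ?thesis by (simp add: divide_inverse mult.commute)
    qed
  qed
  have "((\<lambda>q. arccos (q * h 1) - arccos (q * h 0)) \<longlongrightarrow> arccos (1 * h 1) - arccos (1 * h 0))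
      (at 1 within {0<..<1})"
  proof -
    have "continuous_on {0..1} (\<lambda>q. arccos (q * h s))" if "s \<in> {0..1}" for s
    proof (intro continuous_on_arccos continuous_intros ballI conjI)
      fix q :: real assume "q \<in> {0..1}"
      hence "\<bar>q * h s\<bar> \<le> 1 * 1"
        unfolding abs_mult using h_le[OF that] by (intro mult_mono) auto
      thus "- 1 \<le> q * h s" "q * h s \<le> 1" by (auto simp: abs_le_iff)
    qed
    hence "((\<lambda>q. arccos (q * h s)) \<longlongrightarrow> arccos (1 * h s)) (at 1 within {0..1})"
      if "s \<in> {0..1}" for s
      using that unfolding continuous_on_def by (metis atLeastAtMost_iff order.refl zero_le_one)
    hence "((\<lambda>q. arccos (q * h s)) \<longlongrightarrow> arccos (1 * h s)) (at 1 within {0<..<1})"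
      if "s \<in> {0..1}" for s
      by (rule tendsto_within_subset) (use that in auto)
    thus ?thesis by (intro tendsto_diff) auto
  qed
  moreover have "at (1::real) within {0<..<1} \<noteq> bot"
    by (simp add: trivial_limit_within islimpt_greaterThanLessThan2)
  moreover have "\<forall>\<^sub>F q in at 1 within {0<..<1}.
      arccos (q * h 1) - arccos (q * h 0) \<le> integral {0..1} f"
    unfolding eventually_at_filter by (rule always_eventually) (auto intro!: shrunk)
  ultimately have "arccos (1 * h 1) - arccos (1 * h 0) \<le> integral {0..1} f"
    using tendsto_upperbound by blast
  thus ?thesis by (simp add: h0) (simp add: h_def)
qed

lemma sphere_curve_angle_le:
  fixes c c' :: "real \<Rightarrow> 'a::real_inner"
  assumes "finite S" "continuous_on {0..1} c" "f integrable_on {0..1}" "0 < r"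
    and der: "\<And>t. t \<in> {0<..<1} - S \<Longrightarrow> (c has_vector_derivative c' t) (at t)"
    and speed: "\<And>t. t \<in> {0<..<1} - S \<Longrightarrow> norm (c' t) \<le> r * f t"
    and sphere: "\<And>t. t \<in> {0..1} \<Longrightarrow> norm (c t) = r"
  shows "arccos (inner (c 0) (c 1) / r\<^sup>2) \<le> integral {0..1} f"
proof -
  have "arccos (inner (c 0 /\<^sub>R r) (c 1 /\<^sub>R r)) \<le> integral {0..1} f"
  proof (rule unit_sphere_curve_angle_le[OF assms(1) _ assms(3), where c' = "\<lambda>t. c' t /\<^sub>R r"])
    show "continuous_on {0..1} (\<lambda>t. c t /\<^sub>R r)"
      by (intro continuous_intros assms)
    show "((\<lambda>t. c t /\<^sub>R r) has_vector_derivative c' t /\<^sub>R r) (at t)"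
      if "t \<in> {0<..<1} - S" for t
      by (rule bounded_linear.has_vector_derivative[OF bounded_linear_scaleR_right der[OF that]])
    show "norm (c' t /\<^sub>R r) \<le> f t" if "t \<in> {0<..<1} - S" for t
      using speed[OF that] \<open>0 < r\<close> by (simp add: field_simps)
    show "norm (c t /\<^sub>R r) = 1" if "t \<in> {0..1}" for t
      using sphere[OF that] \<open>0 < r\<close> by simp
  qed
  thus ?thesis by (simp add: power2_eq_square divide_inverse mult_ac)
qed

section \<open>The metric on the manifold of eigen-decompositions\<close>

lemma SO_iff: "U \<in> SO \<longleftrightarrow> orthogonal_matrix U \<and> det U = 1"
  by (simp add: SO_def rotation_matrix_def)

lemma SO_mult: "U \<in> SO \<Longrightarrow> V \<in> SO \<Longrightarrow> U ** V \<in> SO"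
  by (simp add: SO_iff orthogonal_matrix_mul det_mul)

lemma SO_transpose: "U \<in> SO \<Longrightarrow> transpose U \<in> SO"
  by (simp add: SO_iff orthogonal_matrix_transpose det_transpose)

lemma SO_inverse:
  assumes "U \<in> SO"
  shows "transpose U ** U = mat 1" "U ** transpose U = mat 1"
  using assms by (auto simp: SO_iff orthogonal_matrix_def)

lemma vector_derivative_eventually_constant:
  assumes df: "(f has_vector_derivative a) (at x)"
    and ev: "\<forall>\<^sub>F s in at x. f s = b" and fx: "f x = b"
  shows "a = 0"
proof -
  obtain d where d: "d > 0" "\<And>s. s \<noteq> x \<Longrightarrow> dist s x < d \<Longrightarrow> f s = b"
    using ev by (auto simp: eventually_at)
  have "((\<lambda>_. b) has_vector_derivative a) (at x)"
    by (rule has_vector_derivative_transform_within[OF df d(1) UNIV_I]) (metis d(2) fx)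
  thus ?thesis using vector_derivative_unique_at has_vector_derivative_const by blast
qed

text \<open>
  The defining equations of \<open>M\<close> are differentiated along a curve. They are known only on a
  punctured neighbourhood; continuity provides them at the base point.
\<close>

lemma tangent_space_M_space:
  assumes "(A, L) \<in> tangent_space M_space (U, D)"
  shows "transpose (transpose U ** A) = - (transpose U ** A)"
    and "\<And>i j. i \<noteq> j \<Longrightarrow> L $ i $ j = 0"
proof -
  obtain c where c0: "c 0 = (U, D)" and cM: "\<forall>\<^sub>F s in at (0::real). c s \<in> M_space"
    and der: "(c has_vector_derivative (A, L)) (at 0)"
    using assms by (auto simp: tangent_space_def)
  have der1: "((\<lambda>s. fst (c s)) has_vector_derivative A) (at 0)"
    using bounded_linear.has_vector_derivative[OF bounded_linear_fst der] by simp
  have der2: "((\<lambda>s. snd (c s)) has_vector_derivative L) (at 0)"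
    using bounded_linear.has_vector_derivative[OF bounded_linear_snd der] by simp
  define c1 where c1: "c1 = (\<lambda>s. fst (c s))"
  have tr: "((\<lambda>s. transpose (c1 s)) has_vector_derivative transpose A) (at 0)"
    unfolding c1 by (rule bounded_linear.has_vector_derivative[OF transpose_bounded_linear der1])
  have orth: "\<forall>\<^sub>F s in at 0. transpose (c1 s) ** c1 s = mat 1"
    using cM by eventually_elim (auto simp: M_space_def SO_iff orthogonal_matrix_def c1)
  have "((\<lambda>s. transpose (c1 s) ** c1 s) has_vector_derivative
      (transpose (c1 0) ** A + transpose A ** c1 0)) (at 0)"
    by (rule has_vector_derivative_matrix_product[OF tr]) (use der1 c1 in simp)
  moreover have "transpose (c1 0) ** c1 0 = mat 1"
  proof (rule tendsto_unique[OF _ _ tendsto_eventually[OF orth]])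
    have "isCont (\<lambda>s. transpose (c1 s) ** c1 s) 0"
      using calculation has_vector_derivative_continuous by blast
    thus "((\<lambda>s. transpose (c1 s) ** c1 s) \<longlongrightarrow> transpose (c1 0) ** c1 0) (at 0)"
      by (simp add: isCont_def)
  qed simp
  ultimately have "transpose (c1 0) ** A + transpose A ** c1 0 = 0"
    using vector_derivative_eventually_constant orth by blast
  hence "transpose A ** U = - (transpose U ** A)"
    by (simp add: c1 c0 eq_neg_iff_add_eq_0 add.commute)
  thus "transpose (transpose U ** A) = - (transpose U ** A)"
    by (simp add: matrix_transpose_mul)
  fix i j :: 'a assume ij: "i \<noteq> j"
  have lin: "bounded_linear (\<lambda>B :: real^'a^'a. B $ i $ j)"
    by (rule bounded_linear_compose[OF bounded_linear_vec_nth bounded_linear_vec_nth])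
  have derij: "((\<lambda>s. snd (c s) $ i $ j) has_vector_derivative L $ i $ j) (at 0)"
    by (rule bounded_linear.has_vector_derivative[OF lin der2])
  have ev: "\<forall>\<^sub>F s in at 0. snd (c s) $ i $ j = 0"
    using cM by eventually_elim (use ij in \<open>auto simp: M_space_def Diag_plus_def\<close>)
  have "snd (c 0) $ i $ j = 0"
  proof (rule tendsto_unique[OF _ _ tendsto_eventually[OF ev]])
    show "((\<lambda>s. snd (c s) $ i $ j) \<longlongrightarrow> snd (c 0) $ i $ j) (at 0)"
      using has_vector_derivative_continuous[OF derij] by (simp add: isCont_def)
  qed simp
  thus "L $ i $ j = 0" using vector_derivative_eventually_constant[OF derij ev] by simp
qed

lemma derivative_in_tangent_space:
  assumes "\<gamma> ` {0..1} \<subseteq> M" "t \<in> {0<..<1}" "(\<gamma> has_vector_derivative v) (at t)"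
  shows "v \<in> tangent_space M (\<gamma> t)"
  unfolding tangent_space_def
proof (intro CollectI exI[of _ "\<lambda>s. \<gamma> (t + s)"] conjI)
  have "((\<lambda>s. t + s) \<longlongrightarrow> t + 0) (at (0::real))" by (intro tendsto_intros)
  hence "\<forall>\<^sub>F s in at 0. t + s \<in> {0<..<1}"
    using assms(2) by (intro topological_tendstoD) auto
  thus "\<forall>\<^sub>F s in at 0. \<gamma> (t + s) \<in> M"
    by eventually_elim (use assms(1) in auto)
  have "((\<gamma> \<circ> (\<lambda>s. t + s)) has_vector_derivative (1 *\<^sub>R v)) (at 0)"
    by (rule vector_diff_chain_at) (use assms(3) in \<open>auto intro!: derivative_eq_intros\<close>)
  thus "((\<lambda>s. \<gamma> (t + s)) has_vector_derivative v) (at 0)" by (simp add: o_def)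
qed simp

lemma g_SO_skew:
  assumes "orthogonal_matrix U" "transpose (transpose U ** A) = - (transpose U ** A)"
  shows "g_SO U A A = (norm A)\<^sup>2 / 2"
proof -
  define B where "B = transpose U ** A"
  have tB: "transpose B = - B" using assms(2) by (simp add: B_def)
  have "trace (B ** B) = - trace (transpose B ** B)"
    by (simp add: tB matrix_product_simps trace_simps)
  also have "\<dots> = - (norm B)\<^sup>2"
    by (simp add: trace_transpose_mult_eq_inner power2_norm_eq_inner)
  also have "norm B = norm A"
    unfolding B_def using assms(1)
    by (intro norm_orthogonal_mult) (simp add: orthogonal_matrix_transpose)
  finally show ?thesis by (simp add: g_SO_def B_def)
qed

lemma g_Diag_diagonal:
  fixes D L :: "real^'n^'n"
  assumes "D \<in> Diag_plus" "\<And>i j. i \<noteq> j \<Longrightarrow> L $ i $ j = 0"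
  shows "g_Diag D L L = (\<Sum>i\<in>UNIV. (L $ i $ i / D $ i $ i)\<^sup>2)"
proof -
  obtain f where f: "\<forall>i. f i > 0" "D = diag_matrix f" using assms(1) Diag_plus_iff by blast
  have fn: "f i \<noteq> 0" for i using f(1) by (metis less_irrefl)
  obtain l where l: "L = diag_matrix l" using eq_diag_matrix[of L] assms(2) by blast
  show ?thesis
    by (simp add: g_Diag_def f(2) matrix_inv_diag_matrix fn l power2_eq_square)
qed

lemma g_M_tangent:
  assumes "(U, D) \<in> M_space" "(A, L) \<in> tangent_space M_space (U, D)"
  shows "g_M k (U, D) (A, L) (A, L)
       = k * (norm A)\<^sup>2 / 2 + (\<Sum>i\<in>UNIV. (L $ i $ i / D $ i $ i)\<^sup>2)"
  using assms tangent_space_M_space[OF assms(2)]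
  by (simp add: g_M_def g_SO_skew g_Diag_diagonal M_space_def SO_iff)

text \<open>
  The metric is a product metric and its diagonal part a sum of squares, so the total speed
  dominates the rotational speed and the logarithmic speed of each single eigenvalue.
\<close>

lemma speed_components_le:
  assumes "k > 0" "(U, D) \<in> M_space" "(A, L) \<in> tangent_space M_space (U, D)"
  shows "sqrt k * norm A / sqrt 2 \<le> sqrt (g_M k (U, D) (A, L) (A, L))"
    and "\<bar>L $ i $ i / D $ i $ i\<bar> \<le> sqrt (g_M k (U, D) (A, L) (A, L))"
proof -
  let ?s = "\<Sum>i\<in>UNIV. (L $ i $ i / D $ i $ i)\<^sup>2"
  have s0: "0 \<le> ?s" by (intro sum_nonneg) auto
  have "sqrt k * norm A / sqrt 2 = sqrt (k * (norm A)\<^sup>2 / 2)"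
    by (simp add: real_sqrt_mult real_sqrt_divide)
  also have "\<dots> \<le> sqrt (k * (norm A)\<^sup>2 / 2 + ?s)" using s0 by simp
  finally show "sqrt k * norm A / sqrt 2 \<le> sqrt (g_M k (U, D) (A, L) (A, L))"
    by (simp add: g_M_tangent[OF assms(2,3)])
  have "(L $ i $ i / D $ i $ i)\<^sup>2 \<le> ?s"
    by (rule member_le_sum[of i UNIV "\<lambda>i. (L $ i $ i / D $ i $ i)\<^sup>2"]) auto
  hence "sqrt ((L $ i $ i / D $ i $ i)\<^sup>2) \<le> sqrt (k * (norm A)\<^sup>2 / 2 + ?s)"
    using assms(1) by (intro real_sqrt_le_mono) (simp add: add_increasing)
  thus "\<bar>L $ i $ i / D $ i $ i\<bar> \<le> sqrt (g_M k (U, D) (A, L) (A, L))"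
    by (simp add: g_M_tangent[OF assms(2,3)])
qed

text \<open>
  The curves over which \<open>riemannian_dist\<close> takes the infimum.
\<close>

definition admissible_curve ::
  "real \<Rightarrow> (real \<Rightarrow> (real^'n^'n) \<times> (real^'n^'n)) \<Rightarrow> bool" where
  "admissible_curve k \<gamma> \<longleftrightarrow> \<gamma> piecewise_C1_differentiable_on {0..1} \<and> \<gamma> ` {0..1} \<subseteq> M_space \<and>
     curve_speed (g_M k) \<gamma> integrable_on {0..1}"

lemma d_M_eq:
  "d_M k a b = Inf {curve_length (g_M k) \<gamma> | \<gamma>. admissible_curve k \<gamma> \<and> \<gamma> 0 = a \<and> \<gamma> 1 = b}"
  unfolding d_M_def riemannian_dist_def admissible_curve_def
  by (intro arg_cong[of _ _ Inf] Collect_cong) auto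

lemma admissible_curve_components:
  fixes \<gamma> :: "real \<Rightarrow> (real^'n^'n) \<times> (real^'n^'n)"
  assumes "k > 0" "admissible_curve k \<gamma>"
  obtains S A L where "finite S"
    "continuous_on {0..1} (\<lambda>t. fst (\<gamma> t))" "continuous_on {0..1} (\<lambda>t. snd (\<gamma> t))"
    "\<And>t. t \<in> {0<..<1} - S \<Longrightarrow> ((\<lambda>t. fst (\<gamma> t)) has_vector_derivative A t) (at t)"
    "\<And>t. t \<in> {0<..<1} - S \<Longrightarrow> ((\<lambda>t. snd (\<gamma> t)) has_vector_derivative L t) (at t)"
    "\<And>t. t \<in> {0<..<1} - S \<Longrightarrow>
        transpose (transpose (fst (\<gamma> t)) ** A t) = - (transpose (fst (\<gamma> t)) ** A t)"
    "\<And>t. t \<in> {0<..<1} - S \<Longrightarrow> norm (A t) \<le> sqrt (2 / k) * curve_speed (g_M k) \<gamma> t"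
    "\<And>t i. t \<in> {0<..<1} - S \<Longrightarrow>
        \<bar>L t $ i $ i / snd (\<gamma> t) $ i $ i\<bar> \<le> curve_speed (g_M k) \<gamma> t"
proof -
  obtain S where cont: "continuous_on {0..1} \<gamma>" and fin: "finite S"
    and C1: "\<gamma> C1_differentiable_on ({0..1} - S)"
    using assms(2) by (auto simp: admissible_curve_def piecewise_C1_differentiable_on_def)
  have inM: "\<gamma> ` {0..1} \<subseteq> M_space" using assms(2) by (simp add: admissible_curve_def)
  obtain V where V: "\<And>t. t \<in> {0..1} - S \<Longrightarrow> (\<gamma> has_vector_derivative V t) (at t)"
    using C1 unfolding C1_differentiable_on_def by blast
  have tan: "(fst (V t), snd (V t)) \<in> tangent_space M_space (fst (\<gamma> t), snd (\<gamma> t))"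
    if "t \<in> {0<..<1} - S" for t
    using derivative_in_tangent_space[OF inM _ V] that by simp
  have mem: "(fst (\<gamma> t), snd (\<gamma> t)) \<in> M_space" if "t \<in> {0<..<1} - S" for t
    using inM that by auto
  have speed: "curve_speed (g_M k) \<gamma> t
      = sqrt (g_M k (fst (\<gamma> t), snd (\<gamma> t)) (fst (V t), snd (V t)) (fst (V t), snd (V t)))"
    if "t \<in> {0<..<1} - S" for t
    using vector_derivative_at[OF V] that by (simp add: curve_speed_def)
  show ?thesis
  proof (rule that[OF fin])
    fix t assume t: "t \<in> {0<..<1} - S"
    show "((\<lambda>t. fst (\<gamma> t)) has_vector_derivative fst (V t)) (at t)"
      by (rule bounded_linear.has_vector_derivative[OF bounded_linear_fst V]) (use t in auto)
    show "((\<lambda>t. snd (\<gamma> t)) has_vector_derivative snd (V t)) (at t)"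
      by (rule bounded_linear.has_vector_derivative[OF bounded_linear_snd V]) (use t in auto)
    show "transpose (transpose (fst (\<gamma> t)) ** fst (V t)) = - (transpose (fst (\<gamma> t)) ** fst (V t))"
      by (rule tangent_space_M_space(1)[OF tan[OF t]])
    have "sqrt k * norm (fst (V t)) / sqrt 2 \<le> curve_speed (g_M k) \<gamma> t"
      unfolding speed[OF t] by (rule speed_components_le(1)[OF assms(1) mem[OF t] tan[OF t]])
    thus "norm (fst (V t)) \<le> sqrt (2 / k) * curve_speed (g_M k) \<gamma> t"
      using assms(1) by (simp add: real_sqrt_divide field_simps)
    show "\<bar>snd (V t) $ i $ i / snd (\<gamma> t) $ i $ i\<bar> \<le> curve_speed (g_M k) \<gamma> t" for i
      unfolding speed[OF t] by (rule speed_components_le(2)[OF assms(1) mem[OF t] tan[OF t]])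
  qed (use cont in \<open>auto intro: continuous_intros\<close>)
qed

lemma length_ge_log_ratio:
  fixes \<gamma> :: "real \<Rightarrow> (real^'n^'n) \<times> (real^'n^'n)"
  assumes "k > 0" "admissible_curve k \<gamma>"
  shows "\<bar>ln (snd (\<gamma> 1) $ i $ i) - ln (snd (\<gamma> 0) $ i $ i)\<bar> \<le> curve_length (g_M k) \<gamma>"
proof -
  obtain S A L where *: "finite S" "continuous_on {0..1} (\<lambda>t. snd (\<gamma> t))"
    "\<And>t. t \<in> {0<..<1} - S \<Longrightarrow> ((\<lambda>t. snd (\<gamma> t)) has_vector_derivative L t) (at t)"
    "\<And>t i. t \<in> {0<..<1} - S \<Longrightarrow>
        \<bar>L t $ i $ i / snd (\<gamma> t) $ i $ i\<bar> \<le> curve_speed (g_M k) \<gamma> t"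
    by (rule admissible_curve_components[OF assms]) blast
  have pos: "0 < snd (\<gamma> t) $ i $ i" if "t \<in> {0..1}" for t
  proof -
    have "\<gamma> t \<in> M_space" using assms(2) that by (auto simp: admissible_curve_def)
    thus ?thesis by (auto simp: M_space_def Diag_plus_def)
  qed
  have int: "curve_speed (g_M k) \<gamma> integrable_on {0..1}"
    using assms(2) by (simp add: admissible_curve_def)
  define \<phi> where "\<phi> = (\<lambda>t. ln (snd (\<gamma> t) $ i $ i))"
  have lin: "bounded_linear (\<lambda>B :: real^'n^'n. B $ i $ i)"
    by (rule bounded_linear_compose[OF bounded_linear_vec_nth bounded_linear_vec_nth])
  have cont: "continuous_on {0..1} \<phi>"
    unfolding \<phi>_def using pos
    by (intro continuous_on_ln bounded_linear.continuous_on[OF lin] *(2)) force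
  have der: "(\<phi> has_real_derivative L t $ i $ i / snd (\<gamma> t) $ i $ i) (at t)"
    if t: "t \<in> {0<..<1} - S" for t
  proof -
    have "((\<lambda>t. snd (\<gamma> t) $ i $ i) has_real_derivative L t $ i $ i) (at t)"
      unfolding has_real_derivative_iff_has_vector_derivative
      by (rule bounded_linear.has_vector_derivative[OF lin *(3)[OF t]])
    thus ?thesis
      unfolding \<phi>_def using pos[of t] t by (auto intro!: derivative_eq_intros)
  qed
  have le: "L t $ i $ i / snd (\<gamma> t) $ i $ i \<le> curve_speed (g_M k) \<gamma> t"
    "- (L t $ i $ i / snd (\<gamma> t) $ i $ i) \<le> curve_speed (g_M k) \<gamma> t"
    if "t \<in> {0<..<1} - S" for t
    using *(4)[OF that, of i] abs_ge_self abs_ge_minus_self order_trans by blast+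
  have "\<phi> 1 - \<phi> 0 \<le> curve_length (g_M k) \<gamma>"
    unfolding curve_length_def
    by (rule integral_ge_increment[OF *(1) cont int der le(1)])
  moreover have "- \<phi> 1 - - \<phi> 0 \<le> curve_length (g_M k) \<gamma>"
    unfolding curve_length_def
    by (rule integral_ge_increment[OF *(1) continuous_on_minus[OF cont] int
          DERIV_minus[OF der] le(2)])
  ultimately show ?thesis by (simp add: \<phi>_def abs_le_iff)
qed

text \<open>
  A vector carried along by the rotations moves on a sphere, with at most \<open>1 / sqrt 2\<close> times the
  Frobenius speed, and the Frobenius speed is at most \<open>sqrt (2 / k)\<close> times the speed in \<open>M\<close>. This
  bound sees only one rotation angle.
\<close>

lemma length_ge_vector_angle:
  fixes \<gamma> :: "real \<Rightarrow> (real^'n^'n) \<times> (real^'n^'n)"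
  assumes "k > 0" "admissible_curve k \<gamma>" "x \<noteq> 0"
  shows "sqrt k * arccos (inner (fst (\<gamma> 0) *v x) (fst (\<gamma> 1) *v x) / (norm x)\<^sup>2)
       \<le> curve_length (g_M k) \<gamma>"
proof -
  obtain S A L where *: "finite S" "continuous_on {0..1} (\<lambda>t. fst (\<gamma> t))"
    "\<And>t. t \<in> {0<..<1} - S \<Longrightarrow> ((\<lambda>t. fst (\<gamma> t)) has_vector_derivative A t) (at t)"
    "\<And>t. t \<in> {0<..<1} - S \<Longrightarrow>
        transpose (transpose (fst (\<gamma> t)) ** A t) = - (transpose (fst (\<gamma> t)) ** A t)"
    "\<And>t. t \<in> {0<..<1} - S \<Longrightarrow> norm (A t) \<le> sqrt (2 / k) * curve_speed (g_M k) \<gamma> t"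
    by (rule admissible_curve_components[OF assms(1,2)]) blast
  have orth: "orthogonal_matrix (fst (\<gamma> t))" if "t \<in> {0..1}" for t
  proof -
    have "\<gamma> t \<in> M_space" using assms(2) that by (auto simp: admissible_curve_def)
    thus ?thesis by (auto simp: M_space_def SO_iff)
  qed
  let ?f = "\<lambda>t. curve_speed (g_M k) \<gamma> t / sqrt k"
  have int: "?f integrable_on {0..1}"
    using assms(2) by (auto simp: admissible_curve_def intro: integrable_on_divide)
  have "arccos (inner (fst (\<gamma> 0) *v x) (fst (\<gamma> 1) *v x) / (norm x)\<^sup>2) \<le> integral {0..1} ?f"
  proof (rule sphere_curve_angle_le[OF *(1) _ int, where c' = "\<lambda>t. A t *v x"])
    show "continuous_on {0..1} (\<lambda>t. fst (\<gamma> t) *v x)"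
      by (rule bounded_linear.continuous_on[OF matrix_vector_bounded_linear *(2)])
    show "norm (fst (\<gamma> t) *v x) = norm x" if "t \<in> {0..1}" for t
      by (rule orthogonal_matrix_norm[OF orth[OF that]])
    fix t assume t: "t \<in> {0<..<1} - S"
    show "((\<lambda>t. fst (\<gamma> t) *v x) has_vector_derivative A t *v x) (at t)"
      by (rule bounded_linear.has_vector_derivative[OF matrix_vector_bounded_linear *(3)[OF t]])
    have o: "orthogonal_matrix (transpose (fst (\<gamma> t)))"
      using orth[of t] t by (simp add: orthogonal_matrix_transpose)
    have "norm (A t *v x) = norm ((transpose (fst (\<gamma> t)) ** A t) *v x)"
      using orthogonal_matrix_norm[OF o, of "A t *v x"]
      by (simp add: matrix_vector_mul_assoc del: transpose_matrix_vector)
    also have "\<dots> \<le> norm (transpose (fst (\<gamma> t)) ** A t) * norm x / sqrt 2"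
      by (rule norm_skew_mult_vector_le[OF *(4)[OF t]])
    also have "\<dots> = norm (A t) * norm x / sqrt 2"
      by (simp add: norm_orthogonal_mult[OF o])
    also have "\<dots> \<le> (sqrt (2 / k) * curve_speed (g_M k) \<gamma> t) * norm x / sqrt 2"
      using *(5)[OF t] by (intro divide_right_mono mult_right_mono) auto
    also have "\<dots> = norm x * ?f t" using assms(1) by (simp add: real_sqrt_divide field_simps)
    finally show "norm (A t *v x) \<le> norm x * ?f t" .
  qed (use assms(3) in auto)
  also have "\<dots> = curve_length (g_M k) \<gamma> / sqrt k"
    by (simp add: curve_length_def)
  finally show ?thesis using assms(1) by (simp add: field_simps)
qed

text \<open>
  Several rotation angles are seen at once when a whole orthonormal frame of \<open>m\<close> vectors is carried
  along. It is a point on a sphere of radius \<open>sqrt m\<close> in the space of matrices. The cosine in this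
  bound is the average over the frame, so the bound is good when the angles are nearly equal.
\<close>

lemma length_ge_frame_angle:
  fixes \<gamma> :: "real \<Rightarrow> (real^'n^'n) \<times> (real^'n^'n)"
  assumes "k > 0" "admissible_curve k \<gamma>" "finite I" "I \<noteq> {}" "orthonormal_family I x"
  shows "sqrt k * sqrt (card I / 2) *
           arccos ((\<Sum>l\<in>I. inner (fst (\<gamma> 0) *v x l) (fst (\<gamma> 1) *v x l)) / card I)
       \<le> curve_length (g_M k) \<gamma>"
proof -
  obtain S A L where *: "finite S" "continuous_on {0..1} (\<lambda>t. fst (\<gamma> t))"
    "\<And>t. t \<in> {0<..<1} - S \<Longrightarrow> ((\<lambda>t. fst (\<gamma> t)) has_vector_derivative A t) (at t)"
    "\<And>t. t \<in> {0<..<1} - S \<Longrightarrow> norm (A t) \<le> sqrt (2 / k) * curve_speed (g_M k) \<gamma> t"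
    by (rule admissible_curve_components[OF assms(1,2)]) blast
  have orth: "orthogonal_matrix (fst (\<gamma> t))" if "t \<in> {0..1}" for t
  proof -
    have "\<gamma> t \<in> M_space" using assms(2) that by (auto simp: admissible_curve_def)
    thus ?thesis by (auto simp: M_space_def SO_iff)
  qed
  define Q where "Q = span_projection I x"
  define r where "r = sqrt (card I)"
  have cardI: "card I > 0" using assms(3,4) by (simp add: card_gt_0_iff)
  hence r: "r > 0" "r\<^sup>2 = card I" by (auto simp: r_def)
  let ?f = "\<lambda>t. sqrt (2 / k) / r * curve_speed (g_M k) \<gamma> t"
  have int: "?f integrable_on {0..1}"
    using assms(2) unfolding admissible_curve_def by (intro integrable_on_mult_right) auto
  have "arccos (inner (fst (\<gamma> 0) ** Q) (fst (\<gamma> 1) ** Q) / r\<^sup>2) \<le> integral {0..1} ?f"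
  proof (rule sphere_curve_angle_le[OF *(1) _ int r(1), where c' = "\<lambda>t. A t ** Q"])
    show "continuous_on {0..1} (\<lambda>t. fst (\<gamma> t) ** Q)"
      by (intro continuous_on_matrix_product *(2) continuous_intros)
    show "norm (fst (\<gamma> t) ** Q) = r" if "t \<in> {0..1}" for t
    proof -
      have "(norm (fst (\<gamma> t) ** Q))\<^sup>2 = (\<Sum>l\<in>I. inner (x l) (x l))"
        by (simp add: power2_norm_eq_inner Q_def inner_mult_span_projection[OF assms(3,5)]
            orthogonal_matrix_inner[OF orth[OF that]])
      also have "\<dots> = r\<^sup>2"
        using assms(5) by (simp add: r(2) orthonormal_family_def)
      finally show ?thesis using r(1) by (simp add: power2_eq_iff_nonneg)
    qed
    fix t assume t: "t \<in> {0<..<1} - S"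
    show "((\<lambda>t. fst (\<gamma> t) ** Q) has_vector_derivative A t ** Q) (at t)"
      using has_vector_derivative_matrix_product[OF *(3)[OF t] has_vector_derivative_const[of Q]]
      by simp
    have "norm (A t ** Q) \<le> norm (A t)"
      unfolding Q_def by (rule norm_mult_span_projection_le[OF assms(3,5)])
    also have "\<dots> \<le> r * ?f t" using *(4)[OF t] r(1) by simp
    finally show "norm (A t ** Q) \<le> r * ?f t" .
  qed
  also have "\<dots> = sqrt (2 / k) / r * curve_length (g_M k) \<gamma>"
    by (simp add: curve_length_def)
  finally have "arccos ((\<Sum>l\<in>I. inner (fst (\<gamma> 0) *v x l) (fst (\<gamma> 1) *v x l)) / card I)
      \<le> sqrt (2 / k) / r * curve_length (g_M k) \<gamma>"
    by (simp add: Q_def inner_mult_span_projection[OF assms(3,5)] r(2))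
  hence "sqrt k * sqrt (card I / 2) *
           arccos ((\<Sum>l\<in>I. inner (fst (\<gamma> 0) *v x l) (fst (\<gamma> 1) *v x l)) / card I)
       \<le> sqrt k * sqrt (card I / 2) * (sqrt (2 / k) / r * curve_length (g_M k) \<gamma>)"
    using assms(1) by (intro mult_left_mono) auto
  also have "\<dots> = curve_length (g_M k) \<gamma>"
    using assms(1) cardI by (simp add: r_def real_sqrt_divide field_simps)
  finally show ?thesis .
qed

section \<open>Rotations in a plane and connectedness of the rotation group\<close>

definition plane_proj :: "real^'n \<Rightarrow> real^'n \<Rightarrow> real^'n^'n" where
  "plane_proj x y = outer x x + outer y y"

definition plane_turn :: "real^'n \<Rightarrow> real^'n \<Rightarrow> real^'n^'n" where
  "plane_turn x y = outer y x - outer x y"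

definition plane_rotation :: "real^'n \<Rightarrow> real^'n \<Rightarrow> real \<Rightarrow> real^'n^'n" where
  "plane_rotation x y \<theta> =
     mat 1 + (cos \<theta> - 1) *\<^sub>R plane_proj x y + sin \<theta> *\<^sub>R plane_turn x y"

definition orthonormal_pair :: "real^'n \<Rightarrow> real^'n \<Rightarrow> bool" where
  "orthonormal_pair x y \<longleftrightarrow> inner x x = 1 \<and> inner y y = 1 \<and> inner x y = 0"

lemma transpose_plane_proj [simp]: "transpose (plane_proj x y) = plane_proj x y"
  by (simp add: plane_proj_def transpose_simps)

lemma transpose_plane_turn [simp]: "transpose (plane_turn x y) = - plane_turn x y"
  by (simp add: plane_turn_def transpose_simps)

lemma plane_algebra:
  assumes "orthonormal_pair x y"
  shows "plane_proj x y ** plane_proj x y = plane_proj x y"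
    and "plane_proj x y ** plane_turn x y = plane_turn x y"
    and "plane_turn x y ** plane_proj x y = plane_turn x y"
    and "plane_turn x y ** plane_turn x y = - plane_proj x y"
  using assms
  by (simp_all add: plane_proj_def plane_turn_def matrix_product_simps orthonormal_pair_def
      inner_commute[of y x])

lemma plane_rotation_0 [simp]: "plane_rotation x y 0 = mat 1"
  by (simp add: plane_rotation_def)

lemma orthogonal_plane_rotation:
  fixes x y :: "real^'n"
  assumes "orthonormal_pair x y"
  shows "orthogonal_matrix (plane_rotation x y \<theta>)"
proof -
  define P J where "P = plane_proj x y" and "J = plane_turn x y"
  note PJ = plane_algebra[OF assms, folded P_def J_def]
  define N where "N = mat 1 - P"
  have N: "N ** N = N" "N ** P = 0" "P ** N = 0" "N ** J = 0" "J ** N = 0"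
    by (simp_all add: N_def matrix_product_simps PJ)
  have E: "plane_rotation x y \<theta> = N + cos \<theta> *\<^sub>R P + sin \<theta> *\<^sub>R J"
    by (simp add: plane_rotation_def P_def J_def N_def algebra_simps)
  have tE: "transpose (plane_rotation x y \<theta>) = N + cos \<theta> *\<^sub>R P - sin \<theta> *\<^sub>R J"
    by (simp add: E transpose_simps N_def P_def J_def)
  have "transpose (plane_rotation x y \<theta>) ** plane_rotation x y \<theta>
      = N + (cos \<theta> * cos \<theta>) *\<^sub>R P + (sin \<theta> * sin \<theta>) *\<^sub>R P"
    unfolding E tE[unfolded E]
    by (simp add: matrix_product_simps PJ N algebra_simps)
  also have "\<dots> = N + ((cos \<theta>)\<^sup>2 + (sin \<theta>)\<^sup>2) *\<^sub>R P"
    by (simp only: scaleR_add_left power2_eq_square add.assoc)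
  finally show ?thesis by (simp add: orthogonal_matrix N_def)
qed

lemma plane_rotation_mult_turn:
  assumes "orthonormal_pair x y"
  shows "plane_rotation x y \<theta> ** plane_turn x y
       = cos \<theta> *\<^sub>R plane_turn x y - sin \<theta> *\<^sub>R plane_proj x y"
  by (simp add: plane_rotation_def matrix_product_simps plane_algebra[OF assms] algebra_simps)

lemma has_vector_derivative_plane_rotation:
  assumes "orthonormal_pair x y"
  shows "((\<lambda>t. plane_rotation x y (\<omega> * t)) has_vector_derivative
           \<omega> *\<^sub>R (plane_rotation x y (\<omega> * t) ** plane_turn x y)) (at t within S)"
  unfolding plane_rotation_mult_turn[OF assms]
  unfolding plane_rotation_def
  by (rule derivative_eq_intros refl | simp)+ (simp add: algebra_simps)

lemma plane_rotation_first:
  assumes "orthonormal_pair x y"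
  shows "plane_rotation x y \<theta> *v x = cos \<theta> *\<^sub>R x + sin \<theta> *\<^sub>R y"
  using assms
  by (simp add: plane_rotation_def plane_proj_def plane_turn_def matrix_vector_mult_add_rdistrib
      matrix_vector_mult_diff_rdistrib scaleR_matrix_vector_assoc[symmetric] orthonormal_pair_def
      inner_commute[of y x] algebra_simps)

lemma plane_rotation_orthogonal_vector:
  assumes "inner x v = 0" "inner y v = 0"
  shows "plane_rotation x y \<theta> *v v = v"
  using assms
  by (simp add: plane_rotation_def plane_proj_def plane_turn_def matrix_vector_mult_add_rdistrib
      matrix_vector_mult_diff_rdistrib scaleR_matrix_vector_assoc[symmetric])

text \<open>The determinant is a continuous function with values \<open>1\<close> and \<open>-1\<close>.\<close>

lemma det_orthogonal_curve:
  fixes c :: "real \<Rightarrow> real^'n^'n"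
  assumes "continuous_on UNIV c" "\<And>t. orthogonal_matrix (c t)" "c 0 = mat 1"
  shows "det (c t) = 1"
proof -
  have "continuous_on UNIV (\<lambda>t. det (c t))"
    unfolding det_def using assms(1) by (intro continuous_intros)
  moreover have "range (\<lambda>t. det (c t)) \<subseteq> {1, -1}"
    using det_orthogonal_matrix[OF assms(2)] by auto
  hence "finite (range (\<lambda>t. det (c t)))" using finite_subset by blast
  ultimately have "(\<lambda>t. det (c t)) constant_on UNIV"
    by (intro continuous_finite_range_constant) auto
  hence "det (c t) = det (c 0)" by (auto simp: constant_on_def)
  thus ?thesis by (simp add: assms(3))
qed

text \<open>
  Curves defined on the whole real line can be multiplied pointwise. Hence products replace the
  concatenation of paths, and no breakpoints arise.
\<close>

definition C1_connected_to_identity :: "real^'n^'n \<Rightarrow> bool" where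
  "C1_connected_to_identity U \<longleftrightarrow>
     (\<exists>c c'. (\<forall>t. (c has_vector_derivative c' t) (at (t::real))) \<and> continuous_on UNIV c' \<and>
        (\<forall>t. orthogonal_matrix (c t)) \<and> c 0 = mat 1 \<and> c 1 = U)"

lemma continuous_on_if_vector_derivative:
  "(\<And>t. (c has_vector_derivative c' t) (at (t::real))) \<Longrightarrow> continuous_on UNIV c"
  by (meson continuous_at_imp_continuous_on has_vector_derivative_continuous)

lemma C1_connected_mult:
  assumes "C1_connected_to_identity U" "C1_connected_to_identity V"
  shows "C1_connected_to_identity (U ** V)"
proof -
  obtain c c' where c: "\<And>t. (c has_vector_derivative c' t) (at (t::real))" "continuous_on UNIV c'"
      "\<And>t. orthogonal_matrix (c t)" "c 0 = mat 1" "c 1 = U"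
    using assms(1) unfolding C1_connected_to_identity_def by blast
  obtain d d' where d: "\<And>t. (d has_vector_derivative d' t) (at (t::real))" "continuous_on UNIV d'"
      "\<And>t. orthogonal_matrix (d t)" "d 0 = mat 1" "d 1 = V"
    using assms(2) unfolding C1_connected_to_identity_def by blast
  note cont = continuous_on_if_vector_derivative[OF c(1)] continuous_on_if_vector_derivative[OF d(1)]
  show ?thesis
    unfolding C1_connected_to_identity_def
  proof (rule exI[of _ "\<lambda>t. c t ** d t"], rule exI[of _ "\<lambda>t. c t ** d' t + c' t ** d t"],
      intro conjI allI)
    show "((\<lambda>t. c t ** d t) has_vector_derivative c t ** d' t + c' t ** d t) (at t)" for t
      by (rule has_vector_derivative_matrix_product[OF c(1) d(1)])
    show "continuous_on UNIV (\<lambda>t. c t ** d' t + c' t ** d t)"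
      by (intro continuous_intros c(2) d(2) cont)
    show "orthogonal_matrix (c t ** d t)" for t
      by (rule orthogonal_matrix_mul[OF c(3) d(3)])
  qed (simp_all add: c d)
qed

lemma C1_connected_plane_rotation:
  assumes "orthonormal_pair x y"
  shows "C1_connected_to_identity (plane_rotation x y \<theta>)"
  unfolding C1_connected_to_identity_def
proof (intro exI conjI allI)
  let ?c = "\<lambda>t. plane_rotation x y (\<theta> * t)"
  show "(?c has_vector_derivative \<theta> *\<^sub>R (?c t ** plane_turn x y)) (at t)" for t
    by (rule has_vector_derivative_plane_rotation[OF assms])
  show "continuous_on UNIV (\<lambda>t. \<theta> *\<^sub>R (?c t ** plane_turn x y))"
    by (intro continuous_intros
        continuous_on_if_vector_derivative[OF has_vector_derivative_plane_rotation[OF assms]])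
qed (simp_all add: orthogonal_plane_rotation[OF assms])

lemma plane_rotation_in_SO:
  assumes "orthonormal_pair x y"
  shows "plane_rotation x y \<theta> \<in> SO"
proof -
  let ?c = "\<lambda>t. plane_rotation x y (\<theta> * t)"
  have "det (?c 1) = 1"
    by (rule det_orthogonal_curve[OF
          continuous_on_if_vector_derivative[OF has_vector_derivative_plane_rotation[OF assms]]])
       (simp_all add: orthogonal_plane_rotation[OF assms])
  thus ?thesis by (simp add: SO_iff orthogonal_plane_rotation[OF assms])
qed

lemma matrix_eq_axisI:
  fixes A B :: "real^'n^'n"
  assumes "\<And>l. A *v axis l 1 = B *v axis l 1"
  shows "A = B"
  using assms by (simp add: matrix_vector_mult_basis column_def vec_eq_iff)

text \<open>
  The rotation from \<open>e\<close> to \<open>y\<close> takes place in the plane that they span, so it fixes every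
  vector orthogonal to both. For \<open>y = -e\<close> this plane would not be determined.
\<close>

lemma obtain_plane_rotation:
  fixes e y :: "real^'n"
  assumes "inner e e = 1" "inner y y = 1" "y \<noteq> e" "y \<noteq> - e"
  obtains z \<phi> where "orthonormal_pair e z" "plane_rotation e z \<phi> *v e = y"
    "\<And>v. inner e v = 0 \<Longrightarrow> inner y v = 0 \<Longrightarrow> inner z v = 0"
proof -
  define a where "a = inner e y"
  define u where "u = y - a *\<^sub>R e"
  have uu: "inner u u = 1 - a\<^sup>2"
    using assms by (simp add: u_def inner_diff_left inner_diff_right a_def inner_commute
        power2_eq_square)
  have "u \<noteq> 0"
  proof
    assume "u = 0"
    hence "a\<^sup>2 = 1" "y = a *\<^sub>R e" using uu by (auto simp: u_def)
    thus False using assms(3,4) by (auto simp: power2_eq_1_iff)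
  qed
  define z where "z = u /\<^sub>R norm u"
  have "inner e u = 0" using assms by (simp add: u_def inner_diff_right a_def)
  moreover have "norm z = 1" using \<open>u \<noteq> 0\<close> by (simp add: z_def)
  hence "inner z z = 1" by (simp add: norm_eq_1)
  ultimately have on: "orthonormal_pair e z"
    using assms(1) by (simp add: orthonormal_pair_def z_def)
  have "a\<^sup>2 + (norm u)\<^sup>2 = 1" using uu by (simp add: power2_norm_eq_inner)
  then obtain \<phi> where \<phi>: "a = cos \<phi>" "norm u = sin \<phi>" by (rule sincos_total_2pi)
  have "plane_rotation e z \<phi> *v e = a *\<^sub>R e + norm u *\<^sub>R z"
    by (simp add: plane_rotation_first[OF on] \<phi>)
  also have "\<dots> = y" using \<open>u \<noteq> 0\<close> by (simp add: z_def u_def)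
  finally show ?thesis
    by (rule that[OF on]) (simp add: z_def u_def inner_diff_left)
qed

text \<open>
  One plane rotation corrects the image of one further coordinate vector \<open>e\<close> and keeps those already
  fixed. If \<open>e\<close> is sent to \<open>-e\<close>, the second direction of the plane is another coordinate vector that is
  not yet fixed; there is one, because otherwise the matrix would be a reflection with
  determinant \<open>-1\<close>.
\<close>

lemma SO_fixing_C1_connected:
  fixes U :: "real^'n^'n"
  assumes "finite K" "U \<in> SO" "\<And>l. l \<notin> K \<Longrightarrow> U *v axis l 1 = axis l 1"
  shows "C1_connected_to_identity U"
  using assms
proof (induction K arbitrary: U rule: finite_induct)
  case empty
  hence "U = mat 1" by (intro matrix_eq_axisI) simp
  thus ?case
    unfolding C1_connected_to_identity_def
    by - (rule exI[of _ "\<lambda>_. mat 1"], rule exI[of _ "\<lambda>_. 0"], simp add: orthogonal_matrix_id)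
next
  case (insert k K)
  define e where "e = (axis k 1 :: real^'n)"
  define y where "y = U *v e"
  have oU: "orthogonal_matrix U" using insert.prems(1) by (simp add: SO_iff)
  have ee: "inner e e = 1" by (simp add: e_def inner_axis_axis)
  have yy: "inner y y = 1" by (simp add: y_def orthogonal_matrix_inner[OF oU] ee)
  have perp: "inner e (axis l 1) = 0" "inner y (axis l 1) = 0" if "l \<notin> insert k K" for l
  proof -
    show *: "inner e (axis l 1) = 0" using that by (auto simp: e_def inner_axis_axis)
    show "inner y (axis l 1) = 0"
      using orthogonal_matrix_inner[OF oU, of e "axis l 1"] insert.prems(2)[OF that] *
      by (simp add: y_def)
  qed
  show ?case
  proof (cases "y = e")
    case True
    hence "U *v axis l 1 = axis l 1" if "l \<notin> K" for l
      using insert.prems(2)[of l] that by (cases "l = k") (auto simp: y_def e_def)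
    thus ?thesis by (rule insert.IH[OF insert.prems(1)])
  next
    case False
    obtain z \<phi> where z: "orthonormal_pair e z" "plane_rotation e z \<phi> *v e = y"
      "\<And>l. l \<notin> insert k K \<Longrightarrow> inner z (axis l 1) = 0"
    proof (cases "y = - e")
      case True
      have "K \<noteq> {}"
      proof
        assume "K = {}"
        have "U = diag_matrix (\<lambda>i. if i = k then - 1 else 1)"
        proof (rule matrix_eq_axisI)
          fix l
          show "U *v axis l 1 = diag_matrix (\<lambda>i. if i = k then - 1 else 1) *v axis l 1"
            using insert.prems(2)[of l] True \<open>K = {}\<close>
            by (cases "l = k") (auto simp: y_def e_def vec_eq_iff diag_matrix_vector axis_def)
        qed
        hence "det U = - 1" by simp
        thus False using insert.prems(1) by (simp add: SO_iff)
      qed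
      then obtain m where m: "m \<in> K" by blast
      hence "m \<noteq> k" using insert.hyps by auto
      hence on: "orthonormal_pair e (axis m 1)"
        by (simp add: orthonormal_pair_def e_def inner_axis_axis)
      show ?thesis
      proof (rule that[OF on])
        show "plane_rotation e (axis m 1) pi *v e = y"
          by (simp add: plane_rotation_first[OF on] True)
        show "inner (axis m 1 :: real^'n) (axis l 1) = 0" if "l \<notin> insert k K" for l
          using that m by (auto simp: inner_axis_axis)
      qed
    next
      case False
      show ?thesis
        by (rule obtain_plane_rotation[OF ee yy \<open>y \<noteq> e\<close> False])
           (use that perp in blast)
    qed
    define W where "W = plane_rotation e z \<phi>"
    have W: "W \<in> SO" unfolding W_def by (rule plane_rotation_in_SO[OF z(1)])
    have W_inv: "transpose W *v (W *v v) = v" for v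
      using SO_inverse(1)[OF W] by (simp add: matrix_vector_mul_assoc del: transpose_matrix_vector)
    have "C1_connected_to_identity (transpose W ** U)"
    proof (rule insert.IH)
      show "transpose W ** U \<in> SO" by (intro SO_mult SO_transpose W insert.prems(1))
      fix l assume l: "l \<notin> K"
      have "U *v axis l 1 = W *v axis l 1"
      proof (cases "l = k")
        case True
        thus ?thesis using z(2) by (simp add: W_def y_def e_def)
      next
        case False
        thus ?thesis
          using l insert.prems(2)[of l] perp(1)[of l] z(3)[of l]
          by (simp add: W_def plane_rotation_orthogonal_vector)
      qed
      thus "(transpose W ** U) *v axis l 1 = axis l 1"
        by (simp add: matrix_vector_mul_assoc[symmetric] W_inv del: transpose_matrix_vector)
    qed
    moreover have "C1_connected_to_identity W"
      unfolding W_def by (rule C1_connected_plane_rotation[OF z(1)])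
    ultimately have "C1_connected_to_identity (W ** (transpose W ** U))"
      by (rule C1_connected_mult[rotated])
    thus ?thesis by (simp add: matrix_mul_assoc SO_inverse(2)[OF W])
  qed
qed

lemma SO_C1_connected: "U \<in> SO \<Longrightarrow> C1_connected_to_identity U"
  by (rule SO_fixing_C1_connected[of UNIV]) auto

lemma smooth_curve_admissible:
  fixes c L :: "real \<Rightarrow> real^'n^'n"
  assumes inM: "\<And>t. t \<in> {0..1} \<Longrightarrow> (c t, L t) \<in> M_space"
    and c: "\<And>t. (c has_vector_derivative c' t) (at t)" "continuous_on UNIV c'"
    and L: "\<And>t. (L has_vector_derivative L' t) (at t)" "continuous_on UNIV L'"
  shows "admissible_curve k (\<lambda>t. (c t, L t))"
  unfolding admissible_curve_def
proof (intro conjI)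
  let ?\<gamma> = "\<lambda>t. (c t, L t)"
  have der: "(?\<gamma> has_vector_derivative (c' t, L' t)) (at t)" for t
    by (rule has_vector_derivative_Pair[OF c(1) L(1)])
  have "?\<gamma> C1_differentiable_on {0..1}"
    unfolding C1_differentiable_on_def
    by (rule exI[of _ "\<lambda>t. (c' t, L' t)"])
       (use der c(2) L(2) in \<open>auto intro!: continuous_intros intro: continuous_on_subset\<close>)
  thus "?\<gamma> piecewise_C1_differentiable_on {0..1}"
    by (rule C1_differentiable_imp_piecewise)
  show "?\<gamma> ` {0..1} \<subseteq> M_space" using inM by auto
  let ?s = "\<lambda>t. sqrt (k * (norm (c' t))\<^sup>2 / 2 + (\<Sum>i\<in>UNIV. (L' t $ i $ i / L t $ i $ i)\<^sup>2))"
  have pos: "L t $ i $ i \<noteq> 0" if "t \<in> {0..1}" for t i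
    using inM[OF that] by (auto simp: M_space_def Diag_plus_def less_le)
  have contL: "continuous_on UNIV L" by (rule continuous_on_if_vector_derivative[OF L(1)])
  have "continuous_on {0..1} ?s"
    by (intro continuous_intros continuous_on_subset[OF c(2)] continuous_on_subset[OF L(2)]
        continuous_on_subset[OF contL] ballI pos) auto
  hence int: "?s integrable_on {0..1}" by (rule integrable_continuous_interval)
  have speed: "curve_speed (g_M k) ?\<gamma> t = ?s t" if "t \<in> {0..1} - {0, 1}" for t
  proof -
    have "(c' t, L' t) \<in> tangent_space M_space (c t, L t)"
      by (rule derivative_in_tangent_space[of ?\<gamma>, OF _ _ der]) (use inM that in auto)
    thus ?thesis
      using inM[of t] that
      by (simp add: curve_speed_def vector_derivative_at[OF der] g_M_tangent)
  qed
  show "curve_speed (g_M k) ?\<gamma> integrable_on {0..1}"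
    by (rule integrable_spike_finite[of "{0, 1}", OF _ speed int]) simp_all
qed

lemma admissible_curve_exists:
  fixes a b :: "(real^'n^'n) \<times> (real^'n^'n)"
  assumes "a \<in> M_space" "b \<in> M_space"
  shows "\<exists>\<gamma>. admissible_curve k \<gamma> \<and> \<gamma> 0 = a \<and> \<gamma> 1 = b"
proof -
  obtain U D V \<Lambda> where a: "a = (U, D)" and b: "b = (V, \<Lambda>)" by (metis prod.collapse)
  have mem: "U \<in> SO" "V \<in> SO" "D \<in> Diag_plus" "\<Lambda> \<in> Diag_plus"
    using assms by (auto simp: a b M_space_def)
  have "C1_connected_to_identity (transpose U ** V)"
    by (intro SO_C1_connected SO_mult SO_transpose mem)
  then obtain c c' where c: "\<And>t. (c has_vector_derivative c' t) (at (t::real))"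
      "continuous_on UNIV c'" "\<And>t. orthogonal_matrix (c t)" "c 0 = mat 1" "c 1 = transpose U ** V"
    unfolding C1_connected_to_identity_def by blast
  have cSO: "c t \<in> SO" for t
    using c(3)[of t] det_orthogonal_curve[OF continuous_on_if_vector_derivative[OF c(1)] c(3,4)]
    by (simp add: SO_iff)
  define L where "L t = (1 - t) *\<^sub>R D + t *\<^sub>R \<Lambda>" for t
  have LD: "L t \<in> Diag_plus" if "t \<in> {0..1}" for t
  proof -
    have "0 < (1 - t) * d + t * l" if "0 < d" "0 < l" for d l :: real
      using that \<open>t \<in> {0..1}\<close> by (cases "t = 1") (auto intro: add_pos_nonneg)
    thus ?thesis using mem(3,4) by (simp add: Diag_plus_def L_def)
  qed
  have "admissible_curve k (\<lambda>t. (U ** c t, L t))"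
  proof (rule smooth_curve_admissible)
    show "(U ** c t, L t) \<in> M_space" if "t \<in> {0..1}" for t
      using LD[OF that] SO_mult[OF mem(1) cSO] by (simp add: M_space_def)
    show "((\<lambda>t. U ** c t) has_vector_derivative U ** c' t) (at t)" for t
      using has_vector_derivative_matrix_product[OF has_vector_derivative_const[of U] c(1)[of t]]
      by simp
    show "continuous_on UNIV (\<lambda>t. U ** c' t)" by (intro continuous_intros c(2))
    show "(L has_vector_derivative \<Lambda> - D) (at t)" for t
      unfolding L_def by (auto intro!: derivative_eq_intros)
  qed simp
  moreover have "U ** (transpose U ** V) = V"
    by (simp add: matrix_mul_assoc SO_inverse(2)[OF mem(1)])
  ultimately show ?thesis
    by (intro exI[of _ "\<lambda>t. (U ** c t, L t)"]) (simp add: a b c L_def)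
qed

text \<open>
  The infimum in \<open>d_M\<close> is over a nonempty set by \<open>admissible_curve_exists\<close>. This matters because
  the infimum of the empty set of reals is an unspecified number.
\<close>

lemma d_M_geI:
  assumes "a \<in> M_space" "b \<in> M_space"
    and "\<And>\<gamma>. admissible_curve k \<gamma> \<Longrightarrow> \<gamma> 0 = a \<Longrightarrow> \<gamma> 1 = b \<Longrightarrow> m \<le> curve_length (g_M k) \<gamma>"
  shows "m \<le> d_M k a b"
  unfolding d_M_eq
  by (rule cInf_greatest) (use admissible_curve_exists[OF assms(1,2), of k] assms(3) in auto)

lemma curve_length_nonneg:
  assumes "k > 0" "admissible_curve k \<gamma>"
  shows "0 \<le> curve_length (g_M k) \<gamma>"
  using length_ge_log_ratio[OF assms] abs_ge_zero order_trans by blast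

lemma d_M_le:
  assumes "k > 0" "admissible_curve k \<gamma>" "\<gamma> 0 = a" "\<gamma> 1 = b"
  shows "d_M k a b \<le> curve_length (g_M k) \<gamma>"
  unfolding d_M_eq
  by (rule cInf_lower, use assms in blast, rule bdd_belowI[of _ 0])
     (use curve_length_nonneg[OF assms(1)] in auto)

text \<open>
  A curve that attains a lower bound for all distances between the fibres realizes the
  scaling-rotation distance.
\<close>

lemma d_SR_eqI:
  assumes "k > 0" "admissible_curve k \<gamma>" "\<gamma> 0 \<in> fibre X" "\<gamma> 1 \<in> fibre Y"
    and length: "curve_length (g_M k) \<gamma> = m"
    and lower: "\<And>\<delta>. admissible_curve k \<delta> \<Longrightarrow> \<delta> 0 \<in> fibre X \<Longrightarrow> \<delta> 1 \<in> fibre Y \<Longrightarrow>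
        m \<le> curve_length (g_M k) \<delta>"
  shows "d_SR k X Y = m"
  unfolding d_SR_def
proof (rule cInf_eq_minimum)
  have ge: "m \<le> d_M k a b" if "a \<in> fibre X" "b \<in> fibre Y" for a b
    using that by (intro d_M_geI) (auto simp: fibre_def intro!: lower)
  have "d_M k (\<gamma> 0) (\<gamma> 1) = m"
    using d_M_le[OF assms(1,2) refl refl] ge[OF assms(3,4)] length by linarith
  thus "m \<in> {d_M k a b |a b. a \<in> fibre X \<and> b \<in> fibre Y}" using assms(3,4) by blast
  show "m \<le> d" if "d \<in> {d_M k a b |a b. a \<in> fibre X \<and> b \<in> fibre Y}" for d
    using that ge by auto
qed

section \<open>Rotations in a plane are geodesics\<close>

text \<open>
  For \<open>\<gamma>(t) = (E(t), D)\<close> the derivative is \<open>\<omega> E(t) J\<close> with a fixed skew matrix \<open>J\<close> and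
  \<open>J J = -P\<close>. For a tangent vector \<open>A\<close> at \<open>E(t)\<close>, both terms of the geodesic equation are multiples
  of the trace of \<open>P\<close> times \<open>E(t)\<^sup>T A\<close>. The first factor is symmetric and the second skew, so
  both terms vanish.
\<close>

lemma
  fixes x y :: "real^'n" and D :: "real^'n^'n" and \<omega> :: real
  assumes "k > 0" and on: "orthonormal_pair x y" and D: "D \<in> Diag_plus"
  defines "\<gamma> \<equiv> \<lambda>t. (plane_rotation x y (\<omega> * t), D)"
  shows plane_rotation_admissible: "admissible_curve k \<gamma>"
    and plane_rotation_geodesic: "riemannian_geodesic M_space (g_M k) \<gamma>"
    and plane_rotation_length: "curve_length (g_M k) \<gamma> = sqrt k * \<bar>\<omega>\<bar>"
proof -
  define J P where "J = plane_turn x y" and "P = plane_proj x y"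
  note PJ = plane_algebra[OF on, folded P_def J_def]
  define E where "E t = plane_rotation x y (\<omega> * t)" for t
  have \<gamma>: "\<gamma> = (\<lambda>t. (E t, D))" by (simp add: \<gamma>_def E_def)
  have derE: "(E has_vector_derivative \<omega> *\<^sub>R (E t ** J)) (at t within T)" for t T
    unfolding E_def J_def by (rule has_vector_derivative_plane_rotation[OF on])
  have SO_E: "E t \<in> SO" for t unfolding E_def by (rule plane_rotation_in_SO[OF on])
  have oE: "orthogonal_matrix (E t)" for t using SO_E by (simp add: SO_iff)
  have inM: "\<gamma> t \<in> M_space" for t by (simp add: \<gamma> M_space_def SO_E D)
  have contE: "continuous_on UNIV E" by (rule continuous_on_if_vector_derivative[OF derE])
  show "admissible_curve k \<gamma>"
    unfolding \<gamma>
    by (rule smooth_curve_admissible[OF _ derE _ has_vector_derivative_const])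
       (use inM contE in \<open>auto simp: \<gamma> intro!: continuous_intros\<close>)
  have der\<gamma>: "(\<gamma> has_vector_derivative (\<omega> *\<^sub>R (E t ** J), 0)) (at t within T)" for t T
    unfolding \<gamma> by (rule has_vector_derivative_Pair[OF derE has_vector_derivative_const])

  have trP: "trace P = 2"
    using on by (simp add: P_def plane_proj_def trace_simps orthonormal_pair_def)
       (simp add: trace_def outer_def inner_vec_def)
  have tJ: "transpose J = - J" by (simp add: J_def)
  have tE: "transpose (E t) ** (E t ** A) = A" for t A
    using SO_inverse(1)[OF SO_E] by (simp add: matrix_mul_assoc)
  have speed: "curve_speed (g_M k) \<gamma> t = sqrt k * \<bar>\<omega>\<bar>" for t
  proof -
    have "g_M k (\<gamma> t) (\<omega> *\<^sub>R (E t ** J), 0) (\<omega> *\<^sub>R (E t ** J), 0) = k * \<omega>\<^sup>2"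
      by (simp add: \<gamma> g_M_def g_SO_def g_Diag_def matrix_product_simps tE PJ trace_simps trP
          power2_eq_square) (simp add: trace_def)
    thus ?thesis
      by (simp add: curve_speed_def vector_derivative_at[OF der\<gamma>] real_sqrt_mult)
  qed
  show "curve_length (g_M k) \<gamma> = sqrt k * \<bar>\<omega>\<bar>"
    using speed by (simp add: curve_length_def cong: integral_cong)

  show "riemannian_geodesic M_space (g_M k) \<gamma>"
    unfolding riemannian_geodesic_def
  proof (rule exI[of _ "\<lambda>t. (\<omega> *\<^sub>R (E t ** J), 0)"],
      rule exI[of _ "\<lambda>t. (- (\<omega>\<^sup>2 *\<^sub>R (E t ** P)), 0)"], intro ballI conjI)
    fix t :: real assume t: "t \<in> {0..1}"
    show "\<gamma> t \<in> M_space" by (rule inM)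
    show "(\<gamma> has_vector_derivative (\<omega> *\<^sub>R (E t ** J), 0)) (at t within {0..1})"
      by (rule der\<gamma>)
    have "((\<lambda>t. E t ** J) has_vector_derivative (\<omega> *\<^sub>R (E t ** J)) ** J) (at t within {0..1})"
      using has_vector_derivative_matrix_product[OF derE has_vector_derivative_const[of J]]
      by simp
    from bounded_linear.has_vector_derivative[OF bounded_linear_scaleR_right[of \<omega>] this]
    have "((\<lambda>t. \<omega> *\<^sub>R (E t ** J)) has_vector_derivative - (\<omega>\<^sup>2 *\<^sub>R (E t ** P)))
        (at t within {0..1})"
      by (simp add: matrix_product_simps matrix_mul_assoc[symmetric] PJ power2_eq_square)
    thus "((\<lambda>t. (\<omega> *\<^sub>R (E t ** J), 0)) has_vector_derivative
        (- (\<omega>\<^sup>2 *\<^sub>R (E t ** P)), 0)) (at t within {0..1})"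
      by (rule has_vector_derivative_Pair[OF _ has_vector_derivative_const])
    fix v assume "v \<in> tangent_space M_space (\<gamma> t)"
    then obtain A L where v: "v = (A, L)" and
      tan: "(A, L) \<in> tangent_space M_space (E t, D)" by (cases v) (simp add: \<gamma>)
    define B where "B = transpose (E t) ** A"
    have tB: "transpose B = - B" using tangent_space_M_space(1)[OF tan] by (simp add: B_def)
    have tB': "transpose A ** E t = transpose B"
      by (simp add: B_def matrix_transpose_mul)
    have PB: "trace (P ** B) = 0"
      by (rule trace_symmetric_mult_skew[OF _ tB]) (simp add: P_def)
    have mixed: "g_M k (\<gamma> s) (\<omega> *\<^sub>R (E s ** J), 0) v
        = - (k * \<omega> / 2) * trace (J ** (transpose (E s) ** A))" for s
      by (simp add: \<gamma> v g_M_def g_SO_def g_Diag_def matrix_product_simps tE trace_simps)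
         (simp add: trace_def)
    have "((\<lambda>s. J ** (transpose (E s) ** A)) has_vector_derivative
        J ** (transpose (\<omega> *\<^sub>R (E t ** J)) ** A)) (at t within {0..1})"
      using has_vector_derivative_matrix_product[OF has_vector_derivative_const[of J]
          has_vector_derivative_matrix_product[OF
            bounded_linear.has_vector_derivative[OF transpose_bounded_linear derE]
            has_vector_derivative_const[of A]]]
      by simp
    hence "((\<lambda>s. trace (J ** (transpose (E s) ** A))) has_vector_derivative
        trace (J ** (transpose (\<omega> *\<^sub>R (E t ** J)) ** A))) (at t within {0..1})"
      by (rule bounded_linear.has_vector_derivative[OF trace_bounded_linear])
    moreover have "trace (J ** (transpose (\<omega> *\<^sub>R (E t ** J)) ** A)) = \<omega> * trace (P ** B)"
    proof -
      have "J ** (transpose (\<omega> *\<^sub>R (E t ** J)) ** A) = - (\<omega> *\<^sub>R ((J ** J) ** B))"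
        by (simp add: transpose_simps matrix_transpose_mul tJ matrix_product_simps B_def
            matrix_mul_assoc)
      thus ?thesis by (simp add: PJ matrix_product_simps trace_simps)
    qed
    ultimately have "((\<lambda>s. trace (J ** (transpose (E s) ** A))) has_real_derivative 0)
        (at t within {0..1})"
      by (simp add: PB has_real_derivative_iff_has_vector_derivative)
    hence first: "((\<lambda>s. g_M k (\<gamma> s) (\<omega> *\<^sub>R (E s ** J), 0) v) has_real_derivative 0)
        (at t within {0..1})"
      unfolding mixed by (auto intro!: derivative_eq_intros)

    define G where "G = \<omega> *\<^sub>R (E t ** J)"
    have base: "g_M k (\<gamma> t + s *\<^sub>R v) (G, 0) (G, 0)
        = - (k / 2) * trace ((transpose (E t + s *\<^sub>R A) ** G) ** (transpose (E t + s *\<^sub>R A) ** G))"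
      for s by (simp add: \<gamma> v g_M_def g_SO_def g_Diag_def) (simp add: trace_def)
    have inner_der: "((\<lambda>s. transpose (E t + s *\<^sub>R A) ** G) has_vector_derivative
        transpose A ** G) (at 0)"
    proof -
      have "((\<lambda>s. E t + s *\<^sub>R A) has_vector_derivative A) (at 0)"
        by (auto intro!: derivative_eq_intros)
      from has_vector_derivative_matrix_product[OF
          bounded_linear.has_vector_derivative[OF transpose_bounded_linear this]
          has_vector_derivative_const[of G]]
      show ?thesis by simp
    qed
    have "((\<lambda>s. trace ((transpose (E t + s *\<^sub>R A) ** G) ** (transpose (E t + s *\<^sub>R A) ** G)))
        has_vector_derivative
        trace ((transpose (E t) ** G) ** (transpose A ** G) + (transpose A ** G) ** (transpose (E t) ** G)))
        (at 0)"
      using bounded_linear.has_vector_derivative[OF trace_bounded_linear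
          has_vector_derivative_matrix_product[OF inner_der inner_der]]
      by simp
    moreover have "trace ((transpose (E t) ** G) ** (transpose A ** G)
        + (transpose A ** G) ** (transpose (E t) ** G)) = 0"
    proof -
      have EG: "transpose (E t) ** G = \<omega> *\<^sub>R J" by (simp add: G_def matrix_product_simps tE)
      have AG: "transpose A ** G = - (\<omega> *\<^sub>R (B ** J))"
        by (simp add: G_def matrix_product_simps matrix_mul_assoc tB' tB)
      have "trace ((\<omega> *\<^sub>R J) ** (- (\<omega> *\<^sub>R (B ** J)))) = trace ((- (\<omega> *\<^sub>R (B ** J))) ** (\<omega> *\<^sub>R J))"
        by (rule trace_mul_sym)
      moreover have "trace ((- (\<omega> *\<^sub>R (B ** J))) ** (\<omega> *\<^sub>R J)) = \<omega>\<^sup>2 * trace (B ** P)"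
        by (simp add: matrix_product_simps matrix_mul_assoc[symmetric] PJ trace_simps
            power2_eq_square)
      moreover have "trace (B ** P) = 0" using PB by (simp add: trace_mul_sym[of B P])
      ultimately show ?thesis by (simp add: EG AG trace_simps)
    qed
    ultimately have second: "((\<lambda>s. g_M k (\<gamma> t + s *\<^sub>R v) (G, 0) (G, 0)) has_real_derivative 0) (at 0)"
      unfolding base has_real_derivative_iff_has_vector_derivative[symmetric]
      by (auto intro!: derivative_eq_intros)
    show "\<exists>a b. ((\<lambda>s. g_M k (\<gamma> s) (\<omega> *\<^sub>R (E s ** J), 0) v) has_real_derivative a)
          (at t within {0..1}) \<and>
        ((\<lambda>s. g_M k (\<gamma> t + s *\<^sub>R v) (\<omega> *\<^sub>R (E t ** J), 0) (\<omega> *\<^sub>R (E t ** J), 0))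
          has_real_derivative b) (at 0) \<and> a - 1/2 * b = 0"
      using first second unfolding G_def by (intro exI[of _ 0]) auto
  qed
qed

section \<open>Eigen-decompositions of a matrix with distinct eigenvalues\<close>

lemma F_map_in_Sym_plus:
  fixes U D :: "real^'n^'n"
  assumes "(U, D) \<in> M_space"
  shows "F_map (U, D) \<in> Sym_plus"
proof -
  obtain d where d: "\<And>i. d i > 0" "D = diag_matrix d" and U: "U \<in> SO"
    using assms by (auto simp: M_space_def Diag_plus_iff)
  have "0 < inner v (F_map (U, D) *v v)" if "v \<noteq> 0" for v
  proof -
    define u where "u = transpose U *v v"
    have oU: "orthogonal_matrix (transpose U)"
      using SO_transpose[OF U] by (simp add: SO_iff)
    have "norm u = norm v" unfolding u_def by (rule orthogonal_matrix_norm[OF oU])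
    hence "u \<noteq> 0" using that by auto
    then obtain i where i: "u $ i \<noteq> 0" by (auto simp: vec_eq_iff)
    have "inner v (F_map (U, D) *v v) = inner (U *v (D *v u)) v"
      by (simp add: F_map_def u_def matrix_vector_mul_assoc matrix_mul_assoc inner_commute
          del: transpose_matrix_vector)
    also have "\<dots> = inner (D *v u) u"
      by (simp add: inner_matrix_vector_transpose u_def)
    also have "\<dots> = (\<Sum>i\<in>UNIV. d i * (u $ i)\<^sup>2)"
      by (simp add: inner_vec_def d(2) diag_matrix_vector power2_eq_square mult.assoc)
    also have "\<dots> > 0"
      using d(1) i by (intro sum_pos2[of _ i]) (auto simp: less_imp_le)
    finally show ?thesis .
  qed
  moreover have "transpose (F_map (U, D)) = F_map (U, D)"
    by (simp add: F_map_def matrix_transpose_mul d(2) matrix_mul_assoc)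
  ultimately show ?thesis by (simp add: Sym_plus_def)
qed

lemma conjugate_eq_diag_matrixD:
  assumes "V \<in> SO" "V ** diag_matrix f ** transpose V = diag_matrix d"
  shows "V ** diag_matrix f = diag_matrix d ** V"
proof -
  have "V ** diag_matrix f ** transpose V ** V = diag_matrix d ** V"
    using assms(2) by simp
  thus ?thesis by (simp add: matrix_mul_assoc[symmetric] SO_inverse[OF assms(1)])
qed

lemma SO_column_nonzero:
  assumes "V \<in> SO"
  shows "\<exists>a. V $ a $ l \<noteq> 0"
proof (rule ccontr)
  assume "\<nexists>a. V $ a $ l \<noteq> 0"
  hence "V *v axis l 1 = 0" by (simp add: matrix_vector_mult_basis column_def vec_eq_iff)
  moreover have "norm (V *v axis l 1) = 1"
    using assms orthogonal_matrix_norm[of V "axis l 1"] by (simp add: SO_iff)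
  ultimately show False by simp
qed

text \<open>
  The equation says \<open>V D\<^sub>f = D\<^sub>d V\<close>. Compare both sides at a nonzero entry in column \<open>l\<close> of \<open>V\<close>.
\<close>

lemma diagonal_in_range_of_conjugate:
  assumes "V \<in> SO" "V ** diag_matrix f ** transpose V = diag_matrix d"
  shows "f l \<in> range d"
proof -
  obtain a where a: "V $ a $ l \<noteq> 0" using SO_column_nonzero[OF assms(1)] by blast
  have "(V ** diag_matrix f) $ a $ l = (diag_matrix d ** V) $ a $ l"
    by (simp add: conjugate_eq_diag_matrixD[OF assms])
  thus ?thesis using a by (auto simp: mult_diag_matrix_nth diag_matrix_mult_nth)
qed

lemma eigenvalues_F_map:
  fixes U :: "real^'n^'n"
  assumes U: "U \<in> SO"
  shows "eigenvalues (F_map (U, diag_matrix d)) = range d"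
proof (intro equalityI subsetI)
  let ?X = "U ** diag_matrix d ** transpose U"
  fix c assume "c \<in> eigenvalues (F_map (U, diag_matrix d))"
  then obtain v where v: "v \<noteq> 0" "?X *v v = c *\<^sub>R v"
    by (auto simp: eigenvalues_def F_map_def scalar_mult_eq_scaleR)
  define u where "u = transpose U *v v"
  have "norm u = norm v"
    unfolding u_def using SO_transpose[OF U] by (intro orthogonal_matrix_norm) (simp add: SO_iff)
  hence "u \<noteq> 0" using v(1) by auto
  then obtain i where i: "u $ i \<noteq> 0" by (auto simp: vec_eq_iff)
  have "diag_matrix d *v u = transpose U *v (?X *v v)"
    by (simp add: u_def matrix_vector_mul_assoc matrix_mul_assoc SO_inverse[OF U]
        del: transpose_matrix_vector)
  also have "\<dots> = c *\<^sub>R u"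
    by (simp add: v(2) u_def matrix_vector_mult_scaleR del: transpose_matrix_vector)
  finally have "d i * u $ i = c * u $ i"
    by (metis diag_matrix_vector real_scaleR_def vector_scaleR_component)
  thus "c \<in> range d" using i by auto
next
  let ?X = "U ** diag_matrix d ** transpose U"
  fix c assume "c \<in> range d"
  then obtain i where i: "c = d i" by blast
  define v where "v = U *v axis i 1"
  have "norm v = 1"
    unfolding v_def using U orthogonal_matrix_norm[of U "axis i 1"] by (simp add: SO_iff)
  hence "v \<noteq> 0" by auto
  moreover have "?X *v v = c *\<^sub>R v"
  proof -
    have "diag_matrix d *v axis i 1 = d i *\<^sub>R axis i 1"
      by (auto simp: vec_eq_iff diag_matrix_vector axis_def)
    moreover have "?X *v v = U *v (diag_matrix d *v axis i 1)"
      by (simp add: v_def matrix_vector_mul_assoc matrix_mul_assoc[symmetric] SO_inverse[OF U]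
          del: transpose_matrix_vector)
    ultimately show ?thesis by (simp add: v_def i matrix_vector_mult_scaleR)
  qed
  ultimately show "c \<in> eigenvalues (F_map (U, diag_matrix d))"
    by (auto simp: eigenvalues_def F_map_def scalar_mult_eq_scaleR)
qed

definition sign_flip :: "'n set \<Rightarrow> real^'n^'n" where
  "sign_flip J = diag_matrix (\<lambda>i. if i \<in> J then - 1 else 1)"

lemma transpose_sign_flip [simp]: "transpose (sign_flip J) = sign_flip J"
  by (simp add: sign_flip_def)

lemma sign_flip_vector: "(sign_flip J *v v) $ i = (if i \<in> J then - v $ i else v $ i)"
  by (simp add: sign_flip_def diag_matrix_vector)

lemma orthogonal_sign_flip: "orthogonal_matrix (sign_flip J)"
  by (auto simp: orthogonal_matrix sign_flip_def diag_matrix_1[symmetric])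

lemma inner_sign_flip: "inner (sign_flip J *v u) v = inner u (sign_flip J *v v)"
  by (simp add: inner_matrix_vector_transpose del: transpose_matrix_vector)

text \<open>
  A matrix that commutes with a diagonal matrix with distinct entries is diagonal, and an
  orthogonal diagonal matrix has entries \<open>1\<close> and \<open>-1\<close>. The determinant fixes the parity.
\<close>

lemma SO_commuting_with_distinct_diagonal:
  fixes S :: "real^'n^'n"
  assumes "S \<in> SO" "S ** diag_matrix d = diag_matrix d ** S" "inj d"
  obtains J where "S = sign_flip J" "even (card J)"
proof -
  have "S $ a $ b = 0" if "a \<noteq> b" for a b
  proof -
    have "(S ** diag_matrix d) $ a $ b = (diag_matrix d ** S) $ a $ b" by (simp add: assms(2))
    hence "S $ a $ b * d b = d a * S $ a $ b"
      by (simp add: mult_diag_matrix_nth diag_matrix_mult_nth)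
    moreover have "d a \<noteq> d b" using that assms(3) by (simp add: inj_eq)
    ultimately show ?thesis by (simp add: mult.commute)
  qed
  then obtain s where s: "S = diag_matrix s" using eq_diag_matrix[of S] by blast
  have "(\<lambda>i. s i * s i) = (\<lambda>_. 1)"
    using SO_inverse(1)[OF assms(1)] by (simp add: s diag_matrix_1[symmetric])
  hence "s i = 1 \<or> s i = - 1" for i by (metis square_eq_1_iff)
  hence S: "S = sign_flip {i. s i = - 1}"
    unfolding s sign_flip_def diag_matrix_eq_iff by (auto simp: fun_eq_iff)
  have "1 = (\<Prod>i\<in>UNIV. if i \<in> {i. s i = - 1} then - 1 else (1::real))"
    using assms(1) by (subst (asm) S) (simp add: SO_iff sign_flip_def)
  also have "\<dots> = (- 1) ^ card {i. s i = - 1}"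
    by (simp add: prod.If_cases)
  finally have "even (card {i. s i = - 1})"
    by (metis neg_one_odd_power one_neq_neg_one)
  with S show ?thesis by (rule that)
qed

section \<open>A half turn that no change of signs brings closer to the identity\<close>

definition indicator_vec :: "'n set \<Rightarrow> real^'n" where
  "indicator_vec C = (\<chi> i. if i \<in> C then 1 else 0)"

definition unit_indicator :: "'n set \<Rightarrow> real^'n" where
  "unit_indicator C = indicator_vec C /\<^sub>R sqrt (card C)"

lemma inner_indicator_vec: "inner (indicator_vec B) (indicator_vec C) = card (B \<inter> C)"
proof -
  have "inner (indicator_vec B) (indicator_vec C) = (\<Sum>i\<in>UNIV. if i \<in> B \<inter> C then 1 else 0)"
    by (simp add: inner_vec_def indicator_vec_def if_distrib cong: if_cong)
       (intro sum.cong, auto)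
  thus ?thesis by (simp add: sum.If_cases Int_def)
qed

lemma inner_unit_indicator:
  "inner (unit_indicator B) (unit_indicator C) = card (B \<inter> C) / (sqrt (card B) * sqrt (card C))"
  by (simp add: unit_indicator_def inner_indicator_vec divide_inverse mult_ac)

lemma inner_unit_indicator_self:
  fixes C :: "'n::finite set"
  shows "C \<noteq> {} \<Longrightarrow> inner (unit_indicator C) (unit_indicator C) = 1"
  by (simp add: inner_unit_indicator card_gt_0_iff)

definition half_turn :: "real^'n \<Rightarrow> real^'n \<Rightarrow> real^'n^'n" where
  "half_turn x y = plane_rotation x y pi"

lemma half_turn_vector:
  "half_turn x y *v v = v - (2 * inner x v) *\<^sub>R x - (2 * inner y v) *\<^sub>R y"
  by (simp add: half_turn_def plane_rotation_def plane_proj_def matrix_vector_mult_add_rdistrib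
      matrix_vector_mult_diff_rdistrib scaleR_matrix_vector_assoc[symmetric] algebra_simps)

lemma transpose_half_turn [simp]: "transpose (half_turn x y) = half_turn x y"
  by (simp add: half_turn_def plane_rotation_def transpose_simps)

lemma half_turn_in_SO: "orthonormal_pair x y \<Longrightarrow> half_turn x y \<in> SO"
  unfolding half_turn_def by (rule plane_rotation_in_SO)

lemma length_ge_pi_if_reversed:
  fixes \<gamma> :: "real \<Rightarrow> (real^'n^'n) \<times> (real^'n^'n)"
  assumes "k > 0" "admissible_curve k \<gamma>" and W: "fst (\<gamma> 1) \<in> SO"
    and start: "fst (\<gamma> 0) = sign_flip J ** (R ** fst (\<gamma> 1))"
    and "v \<noteq> 0" and rev: "R *v v = - (sign_flip J *v v)"
  shows "sqrt k * pi \<le> curve_length (g_M k) \<gamma>"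
proof -
  define u where "u = transpose (fst (\<gamma> 1)) *v v"
  have Wu: "fst (\<gamma> 1) *v u = v"
    by (simp add: u_def matrix_vector_mul_assoc SO_inverse[OF W] del: transpose_matrix_vector)
  have "norm (fst (\<gamma> 1) *v u) = norm u"
    using W by (intro orthogonal_matrix_norm) (simp add: SO_iff)
  hence nu: "norm u = norm v" by (simp add: Wu)
  have "fst (\<gamma> 0) *v u = sign_flip J *v (R *v v)"
    by (simp add: start matrix_vector_mul_assoc[symmetric] Wu)
  hence "inner (fst (\<gamma> 0) *v u) (fst (\<gamma> 1) *v u) = inner (R *v v) (sign_flip J *v v)"
    by (simp add: Wu inner_sign_flip)
  also have "\<dots> = - (norm v)\<^sup>2"
    by (simp add: rev orthogonal_matrix_inner[OF orthogonal_sign_flip] power2_norm_eq_inner)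
  finally have "inner (fst (\<gamma> 0) *v u) (fst (\<gamma> 1) *v u) / (norm u)\<^sup>2 = - 1"
    using \<open>v \<noteq> 0\<close> by (simp add: nu)
  moreover have "u \<noteq> 0" using nu \<open>v \<noteq> 0\<close> by auto
  ultimately show ?thesis using length_ge_vector_angle[OF assms(1,2), of u] by simp
qed

text \<open>
  The numerical margin is about one and a half percent. The claim is
  \<open>cos (\<pi> / sqrt 2) \<ge> -19/30\<close>, that is \<open>sin \<delta> \<le> 19/30\<close> for \<open>\<delta> = \<pi> / sqrt 2 - \<pi> / 2\<close>, which is
  close to \<open>0.6507\<close>.
\<close>

lemma pi_le_sqrt2_arccos: "pi \<le> sqrt 2 * arccos (- 19 / 30)"
proof -
  define \<delta> where "\<delta> = pi / sqrt 2 - pi / 2"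
  have s2: "sqrt 2 \<le> 1.41422" by (rule real_le_lsqrt) (auto simp: power2_eq_square)
  have s2': "1.4142 \<le> sqrt 2" by (rule real_le_rsqrt) (auto simp: power2_eq_square)
  have "\<delta> = pi * ((sqrt 2 - 1) / 2)" by (simp add: \<delta>_def field_simps)
  also have "\<dots> \<le> 3.1416 * ((1.41422 - 1) / 2)"
    using pi_approx s2 s2' by (intro mult_mono) auto
  finally have \<delta>1: "\<delta> \<le> 0.651" by simp
  have \<delta>0: "0 \<le> \<delta>" using s2 by (simp add: \<delta>_def field_simps)
  have "sin \<delta> \<le> sin 0.651"
    using \<delta>0 \<delta>1 pi_approx by (intro sin_monotone_2pi_le) auto
  also have "\<dots> \<le> 19 / 30"
  proof -
    have "{..<4} = {0, 1, 2, 3 :: nat}" by auto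
    hence "(\<Sum>m<4. sin_coeff m * u ^ m) = u - u ^ 3 / 6" for u :: real
      by (simp add: sin_coeff_def fact_numeral)
    hence "\<bar>sin u - (u - u ^ 3 / 6)\<bar> \<le> \<bar>u\<bar> ^ 4 / 24" for u :: real
      using Maclaurin_sin_bound[of u 4] by (simp add: fact_numeral)
    from abs_le_D1[OF this[of "0.651"]]
    have "sin 0.651 \<le> 0.651 - 0.651 ^ 3 / 6 + \<bar>0.651\<bar> ^ 4 / (24 :: real)"
      by (simp only: diff_le_eq add.commute)
    also have "\<dots> \<le> 19 / 30" by (simp add: power3_eq_cube power4_eq_xxxx)
    finally show ?thesis .
  qed
  finally have "- 19 / 30 \<le> cos (\<delta> + pi / 2)" by (simp add: cos_add)
  also have "\<delta> + pi / 2 = pi / sqrt 2" by (simp add: \<delta>_def)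
  finally have "arccos (cos (pi / sqrt 2)) \<le> arccos (- 19 / 30)"
    by (intro arccos_le_arccos) auto
  moreover have "pi / sqrt 2 \<le> pi" using s2' by (simp add: divide_le_eq)
  ultimately have "pi / sqrt 2 \<le> arccos (- 19 / 30)" by (simp add: arccos_cos)
  thus ?thesis by (simp add: pos_divide_le_eq mult.commute)
qed

lemma orthonormal_unit_indicators:
  fixes \<C> :: "'n::finite set set"
  assumes "disjoint \<C>" "{} \<notin> \<C>"
  shows "orthonormal_family \<C> unit_indicator"
  using assms unfolding orthonormal_family_def
  by (auto simp: inner_unit_indicator_self inner_unit_indicator disjoint_def)

lemma inner_half_turn_unit_indicator:
  fixes C :: "'n::finite set"
  assumes "C \<noteq> {}"
  shows "inner (half_turn (unit_indicator A) (unit_indicator B) *v unit_indicator C) (unit_indicator C)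
    = 1 - 2 * (card (A \<inter> C))\<^sup>2 / (card A * card C) - 2 * (card (B \<inter> C))\<^sup>2 / (card B * card C)"
proof -
  have sq: "(inner (unit_indicator E) (unit_indicator C))\<^sup>2 = (card (E \<inter> C))\<^sup>2 / (card E * card C)"
    for E :: "'n set"
    by (simp add: inner_unit_indicator power_divide power_mult_distrib)
  show ?thesis
    by (simp add: half_turn_vector inner_diff_left inner_unit_indicator_self[OF assms]
        power2_eq_square[symmetric] sq mult.assoc)
qed

text \<open>
  Let \<open>R\<close> be the half turn in the plane of the two indicator vectors and \<open>S\<close>
  the change of signs on \<open>J\<close>. Unless \<open>J\<close> meets each of \<open>A\<close> and \<open>B\<close> in exactly one point and
  has no others, \<open>R\<close> and \<open>S\<close> map some nonzero vector to opposite vectors. In the remaining case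
  \<open>S R\<close> rotates in two planes of vectors supported on \<open>A\<close> and on \<open>B\<close>, by angles with cosines
  \<open>2/6 - 1\<close> and \<open>2/5 - 1\<close>. A frame of these planes is given by the normalized indicators of
  \<open>{i}\<close>, \<open>A - {i}\<close>, \<open>{j}\<close>, \<open>B - {j}\<close>. The two angles are almost equal, so the frame bound loses
  little; the average cosine is \<open>-19/30\<close>.
\<close>

lemma length_ge_pi_half_turn:
  fixes \<gamma> :: "real \<Rightarrow> (real^'n^'n) \<times> (real^'n^'n)" and A B J :: "'n set"
  assumes "k > 0" "admissible_curve k \<gamma>" and W: "fst (\<gamma> 1) \<in> SO"
    and AB: "A \<inter> B = {}" "card A = 6" "card B = 5" and even: "even (card J)"
    and start: "fst (\<gamma> 0) =
        sign_flip J ** (half_turn (unit_indicator A) (unit_indicator B) ** fst (\<gamma> 1))"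
  shows "sqrt k * pi \<le> curve_length (g_M k) \<gamma>"
proof -
  define x y where "x = unit_indicator A" and "y = unit_indicator B"
  define R where "R = half_turn x y"
  define S where "S = sign_flip J"
  have ne: "A \<noteq> {}" "B \<noteq> {}" using AB(2,3) by auto
  have Rv: "R *v v = v - (2 * inner x v) *\<^sub>R x - (2 * inner y v) *\<^sub>R y" for v
    by (simp add: R_def half_turn_vector)
  have xx: "inner x x = 1" "inner y x = 0"
    using inner_unit_indicator_self[OF ne(1)] AB(1)
    by (auto simp: x_def y_def inner_unit_indicator Int_commute)
  have reversed: ?thesis if "v \<noteq> 0" "R *v v = - (S *v v)" for v
    using length_ge_pi_if_reversed[OF assms(1-3), of J R v] start that
    by (simp add: R_def S_def x_def y_def)
  have inner_axis_unit: "inner (unit_indicator C) (axis i 1) = (if i \<in> C then 1 / sqrt (card C) else 0)"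
    for C :: "'n set" and i
    by (simp add: unit_indicator_def indicator_vec_def inner_axis divide_inverse)
  have pair: ?thesis if ij: "i \<in> J" "j \<in> J" "i \<noteq> j" "i \<in> A \<and> j \<in> A \<or> i \<in> B \<and> j \<in> B" for i j
  proof (rule reversed[of "axis i 1 - axis j 1"])
    show "axis i 1 - axis j 1 \<noteq> (0 :: real^'n)"
      using ij by (auto simp: vec_eq_iff axis_def)
    have "inner x (axis i 1 - axis j 1) = 0" "inner y (axis i 1 - axis j 1) = 0"
      using ij AB(1) by (auto simp: x_def y_def inner_diff_right inner_axis_unit)
    hence "R *v (axis i 1 - axis j 1) = axis i 1 - axis j 1" by (simp add: Rv)
    moreover have "S *v (axis i 1 - axis j 1) = - (axis i 1 - axis j 1)"
      using ij by (auto simp: vec_eq_iff S_def sign_flip_vector axis_def)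
    ultimately show "R *v (axis i 1 - axis j 1) = - (S *v (axis i 1 - axis j 1))" by simp
  qed
  consider "J = {}" | i where "i \<in> J" "i \<notin> A \<union> B"
    | i j where "i \<in> J" "j \<in> J" "i \<noteq> j" "i \<in> A \<and> j \<in> A \<or> i \<in> B \<and> j \<in> B"
    | i j where "J = {i, j}" "i \<in> A" "j \<in> B"
  proof (cases "\<exists>i\<in>J. i \<notin> A \<union> B \<or> (\<exists>j\<in>J. i \<noteq> j \<and> (i \<in> A \<and> j \<in> A \<or> i \<in> B \<and> j \<in> B))")
    case True
    thus ?thesis using that(2,3) by blast
  next
    case False
    hence AJ: "\<And>i j. i \<in> J \<inter> A \<Longrightarrow> j \<in> J \<inter> A \<Longrightarrow> i = j"
      and BJ: "\<And>i j. i \<in> J \<inter> B \<Longrightarrow> j \<in> J \<inter> B \<Longrightarrow> i = j" and J: "J = (J \<inter> A) \<union> (J \<inter> B)"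
      by blast+
    have single: "C = {} \<or> (\<exists>i. C = {i})" if "\<And>i j. i \<in> C \<Longrightarrow> j \<in> C \<Longrightarrow> i = j" for C :: "'n set"
      using that by blast
    have "J \<noteq> {i}" for i using even by auto
    with single[of "J \<inter> A", OF AJ] single[of "J \<inter> B", OF BJ] J that(1,4)
    show ?thesis by (metis Int_iff Un_empty_left Un_empty_right insertI1 insert_is_Un)
  qed
  thus ?thesis
  proof cases
    case 1
    have "S = mat 1" by (simp add: S_def sign_flip_def 1 diag_matrix_1)
    moreover have "x \<noteq> 0" using xx by auto
    moreover have "R *v x = - x" by (simp add: Rv xx scaleR_2)
    ultimately show ?thesis by (intro reversed[of x]) auto
  next
    case (2 i)
    have "R *v axis i 1 = axis i 1"
      using 2 by (simp add: Rv x_def y_def inner_axis_unit)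
    moreover have "S *v axis i 1 = - axis i 1"
      using 2 by (auto simp: vec_eq_iff S_def sign_flip_vector axis_def)
    ultimately show ?thesis by (intro reversed[of "axis i 1"]) auto
  next
    case (3 i j)
    thus ?thesis by (rule pair)
  next
    case (4 i j)
    have ij: "i \<noteq> j" "i \<notin> B" "j \<notin> A" using 4 AB(1) by auto
    define W where "W = fst (\<gamma> 1)"
    define \<C> where "\<C> = {{i}, A - {i}, {j}, B - {j}}"
    have cards: "card (A - {i}) = 5" "card (B - {j}) = 4"
      using 4 AB by auto
    hence ne': "A - {i} \<noteq> {}" "B - {j} \<noteq> {}"
      by (metis card.empty zero_neq_numeral)+
    have dist: "{i} \<noteq> A - {i}" "{i} \<noteq> {j}" "{i} \<noteq> B - {j}" "A - {i} \<noteq> {j}" "A - {i} \<noteq> B - {j}"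
        "{j} \<noteq> B - {j}"
      using ne' ij AB(1) by auto
    have "card \<C> = 4" using dist by (simp add: \<C>_def)
    have "disjoint \<C>" using 4 ij AB(1) by (auto simp: \<C>_def disjoint_def)
    moreover have "{} \<notin> \<C>" using ne' by (auto simp: \<C>_def)
    ultimately have on: "orthonormal_family \<C> unit_indicator"
      by (rule orthonormal_unit_indicators)
    \<comment> \<open>The curve ends at \<open>W\<close>; this frame is carried to the unit indicators at its end.\<close>
    define f where "f C = transpose W *v unit_indicator C" for C
    have oWt: "orthogonal_matrix (transpose W)"
      using SO_transpose[OF W] by (simp add: SO_iff W_def)
    have onf: "orthonormal_family \<C> f"
      using on by (simp add: orthonormal_family_def f_def orthogonal_matrix_inner[OF oWt]
          del: transpose_matrix_vector)
    have Wf: "W *v f C = unit_indicator C" for C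
      using SO_inverse(2)[OF W]
      by (simp add: f_def W_def matrix_vector_mul_assoc del: transpose_matrix_vector)
    have inner_frame: "inner (fst (\<gamma> 0) *v f C) (fst (\<gamma> 1) *v f C)
        = inner (R *v unit_indicator C) (S *v unit_indicator C)" for C
    proof -
      have "fst (\<gamma> 0) *v f C = S *v (R *v unit_indicator C)"
        by (simp add: start matrix_vector_mul_assoc[symmetric] W_def[symmetric] Wf S_def R_def
            x_def y_def)
      thus ?thesis
        by (simp add: W_def[symmetric] Wf S_def inner_sign_flip)
    qed
    have flip: "S *v unit_indicator {i} = - unit_indicator {i}"
        "S *v unit_indicator {j} = - unit_indicator {j}"
        "S *v unit_indicator (A - {i}) = unit_indicator (A - {i})"
        "S *v unit_indicator (B - {j}) = unit_indicator (B - {j})"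
      using 4 ij by (auto simp: vec_eq_iff S_def sign_flip_vector unit_indicator_def indicator_vec_def)
    have ints: "A \<inter> {i} = {i}" "B \<inter> {i} = {}" "A \<inter> {j} = {}" "B \<inter> {j} = {j}"
        "A \<inter> (A - {i}) = A - {i}" "B \<inter> (A - {i}) = {}" "A \<inter> (B - {j}) = {}"
        "B \<inter> (B - {j}) = B - {j}"
      using 4 ij AB(1) by auto
    have vals: "inner (R *v unit_indicator {i}) (unit_indicator {i}) = 2 / 3"
        "inner (R *v unit_indicator {j}) (unit_indicator {j}) = 3 / 5"
        "inner (R *v unit_indicator (A - {i})) (unit_indicator (A - {i})) = - 2 / 3"
        "inner (R *v unit_indicator (B - {j})) (unit_indicator (B - {j})) = - 3 / 5"
      using ne' by (simp_all add: R_def x_def y_def inner_half_turn_unit_indicator ints cards AB)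
    have "(\<Sum>C\<in>\<C>. inner (fst (\<gamma> 0) *v f C) (fst (\<gamma> 1) *v f C)) = - 38 / 15"
      unfolding inner_frame using dist by (simp add: \<C>_def flip vals)
    hence "sqrt k * sqrt 2 * arccos (- 19 / 30) \<le> curve_length (g_M k) \<gamma>"
      using length_ge_frame_angle[OF assms(1,2) _ _ onf] \<open>card \<C> = 4\<close> by (simp add: \<C>_def)
    moreover have "sqrt k * pi \<le> sqrt k * (sqrt 2 * arccos (- 19 / 30))"
      using pi_le_sqrt2_arccos assms(1) by (intro mult_left_mono) auto
    ultimately show ?thesis by (simp add: mult.assoc)
  qed
qed

text \<open>
  Two eigen-decompositions with the same diagonal part differ, up to the half turn, by a change
  of signs only. If the diagonal parts differ, the curve must carry some eigenvalue to another
  one, and the logarithmic gap alone makes it long.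
\<close>

lemma length_ge_pi_between_fibres:
  fixes \<gamma> :: "real \<Rightarrow> (real^'n^'n) \<times> (real^'n^'n)" and A B :: "'n set" and d :: "'n \<Rightarrow> real"
  assumes "k > 0" "admissible_curve k \<gamma>"
    and AB: "A \<inter> B = {}" "card A = 6" "card B = 5"
    and "inj d" and gap: "\<And>i j. i \<noteq> j \<Longrightarrow> sqrt k * pi \<le> \<bar>ln (d i) - ln (d j)\<bar>"
  defines "R \<equiv> half_turn (unit_indicator A) (unit_indicator B)"
  assumes start: "\<gamma> 0 \<in> fibre (diag_matrix d)" and finish: "\<gamma> 1 \<in> fibre (F_map (R, diag_matrix d))"
  shows "sqrt k * pi \<le> curve_length (g_M k) \<gamma>"
proof -
  have "orthonormal_pair (unit_indicator A) (unit_indicator B)"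
    using AB by (auto simp: orthonormal_pair_def inner_unit_indicator inner_unit_indicator_self)
  hence R: "R \<in> SO" unfolding R_def by (rule half_turn_in_SO)
  obtain V1 f1 where V1: "\<gamma> 0 = (V1, diag_matrix f1)" "V1 \<in> SO"
      "V1 ** diag_matrix f1 ** transpose V1 = diag_matrix d"
    using start by (cases "\<gamma> 0") (auto simp: fibre_def M_space_def Diag_plus_iff F_map_def)
  obtain V2 f2 where V2: "\<gamma> 1 = (V2, diag_matrix f2)" "V2 \<in> SO"
      "V2 ** diag_matrix f2 ** transpose V2 = R ** diag_matrix d ** transpose R"
    using finish by (cases "\<gamma> 1") (auto simp: fibre_def M_space_def Diag_plus_iff F_map_def)
  define W where "W = R ** V2"
  have W: "W \<in> SO" unfolding W_def by (rule SO_mult[OF R V2(2)])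
  have RR: "R ** R = mat 1" using SO_inverse(1)[OF R] by (simp add: R_def)
  have Wd: "W ** diag_matrix f2 ** transpose W = diag_matrix d"
  proof -
    have "W ** diag_matrix f2 ** transpose W = R ** (V2 ** diag_matrix f2 ** transpose V2) ** R"
      by (simp add: W_def matrix_transpose_mul matrix_mul_assoc R_def)
    also have "\<dots> = (R ** R) ** diag_matrix d ** (R ** R)"
      unfolding V2(3) by (simp add: matrix_mul_assoc R_def)
    finally show ?thesis by (simp add: RR)
  qed
  show ?thesis
  proof (cases "f1 = f2")
    case False
    then obtain l where l: "f1 l \<noteq> f2 l" by auto
    obtain i j where ij: "f1 l = d i" "f2 l = d j"
      using diagonal_in_range_of_conjugate[OF V1(2,3), of l]
        diagonal_in_range_of_conjugate[OF W Wd, of l] by auto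
    hence "sqrt k * pi \<le> \<bar>ln (d j) - ln (d i)\<bar>" using l by (intro gap) auto
    also have "\<dots> \<le> curve_length (g_M k) \<gamma>"
      using length_ge_log_ratio[OF assms(1,2), of l] by (simp add: V1(1) V2(1) ij)
    finally show ?thesis .
  next
    case True
    define S where "S = V1 ** transpose W"
    have S: "S \<in> SO" unfolding S_def by (intro SO_mult SO_transpose V1(2) W)
    have "S ** diag_matrix d = V1 ** (transpose W ** W) ** diag_matrix f2 ** transpose W"
      unfolding Wd[symmetric] by (simp add: S_def matrix_mul_assoc)
    also have "\<dots> = V1 ** diag_matrix f1 ** transpose W"
      by (simp add: SO_inverse[OF W] True)
    also have "\<dots> = diag_matrix d ** S"
      by (simp add: conjugate_eq_diag_matrixD[OF V1(2,3)] S_def matrix_mul_assoc)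
    finally obtain J where J: "S = sign_flip J" "even (card J)"
      using SO_commuting_with_distinct_diagonal[OF S _ \<open>inj d\<close>] by blast
    have "S ** W = V1"
      by (simp add: S_def matrix_mul_assoc[symmetric] SO_inverse[OF W])
    hence "fst (\<gamma> 0) = sign_flip J ** (R ** fst (\<gamma> 1))"
      by (simp add: V1(1) V2(1) J(1) W_def)
    thus ?thesis
      using length_ge_pi_half_turn[OF assms(1,2) _ AB J(2)] V2 by (simp add: R_def)
  qed
qed

section \<open>The two opposite half turns\<close>

text \<open>
  The quarter turns are \<open>N + J\<close> and \<open>N - J\<close> with \<open>N = 1 - P\<close>. Equal conjugates mean
  \<open>J D N = N D J\<close>. Multiplication with \<open>J\<close> from the left kills the right-hand side and leaves
  \<open>P D N = 0\<close>: the symmetric matrix \<open>D\<close> preserves the plane.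
\<close>

lemma quarter_turns_conjugate_eqD:
  fixes x y :: "real^'n" and D :: "real^'n^'n"
  assumes on: "orthonormal_pair x y" and D: "transpose D = D"
    and eq: "F_map (plane_rotation x y (pi / 2), D) = F_map (plane_rotation x y (- (pi / 2)), D)"
  shows "plane_proj x y ** D = D ** plane_proj x y"
proof -
  define P J N where "P = plane_proj x y" and "J = plane_turn x y" and "N = mat 1 - P"
  note PJ = plane_algebra[OF on, folded P_def J_def]
  have JN: "J ** N = 0" by (simp add: N_def matrix_product_simps PJ)
  have E: "plane_rotation x y (pi / 2) = N + J" "plane_rotation x y (- (pi / 2)) = N - J"
    by (simp_all add: plane_rotation_def P_def J_def N_def)
  have t: "transpose N = N" "transpose J = - J" "transpose P = P"
    by (simp_all add: N_def P_def J_def transpose_simps)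
  have "(N + J) ** D ** (N - J) = (N - J) ** D ** (N + J)"
    using eq by (simp add: F_map_def E transpose_simps t)
  hence "2 *\<^sub>R (J ** D ** N) = 2 *\<^sub>R (N ** D ** J)"
    by (simp add: matrix_product_simps algebra_simps scaleR_2)
  hence "J ** D ** N = N ** D ** J" by simp
  hence "J ** (J ** D ** N) = J ** (N ** D ** J)" by simp
  hence "P ** D ** N = 0" by (simp add: matrix_mul_assoc PJ JN matrix_product_simps)
  hence PD: "P ** D = P ** D ** P" by (simp add: N_def matrix_product_simps)
  hence "transpose (P ** D) = transpose (P ** D ** P)" by simp
  hence "D ** P = P ** D ** P" by (simp add: matrix_transpose_mul t D matrix_mul_assoc)
  thus ?thesis using PD by (simp add: P_def)
qed

theorem corollary3p21:
  fixes k :: real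
  assumes "k > 0"
    and "CARD('n::finite) \<ge> 11"
  shows "(\<exists>U D V \<Lambda> :: real^'n^'n.
            (U, D) \<in> M_space \<and> (V, \<Lambda>) \<in> M_space \<and>
            geodesically_antipodal (U, D) (V, \<Lambda>) \<and>
            minimal_pair k (U, D) (V, \<Lambda>) \<and>
            distinct_diagonal D \<and> distinct_diagonal \<Lambda>)
       \<and> (\<exists>X\<in>Sym_plus. \<exists>Y\<in>Sym_plus :: (real^'n^'n) set.
            card (eigenvalues X) = CARD('n) \<and> card (eigenvalues Y) = CARD('n) \<and>
            type_II_nonunique k X Y)"
proof -
  obtain T :: "'n set" where T: "card T = 11"
    using assms(2) obtain_subset_with_card_n[of 11 "UNIV :: 'n set"] by auto
  obtain A where A: "A \<subseteq> T" "card A = 6"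
    using obtain_subset_with_card_n[of 6 T] T by auto
  define B where "B = T - A"
  have AB: "A \<inter> B = {}" "card B = 5"
    using A T by (auto simp: B_def card_Diff_subset finite_subset)
  define x y where "x = unit_indicator A" and "y = unit_indicator B"
  have on: "orthonormal_pair x y"
    using A(2) AB
    by (auto simp: x_def y_def orthonormal_pair_def inner_unit_indicator inner_unit_indicator_self)
  define R where "R = half_turn x y"
  have R: "R \<in> SO" unfolding R_def by (rule half_turn_in_SO[OF on])
  have RR: "R ** R = mat 1" using SO_inverse(1)[OF R] by (simp add: R_def)

  obtain idx :: "'n \<Rightarrow> nat" where idx: "inj idx"
    using finite_imp_inj_to_nat_seg[of "UNIV :: 'n set"] by auto
  \<comment> \<open>Exchanging two eigenvalues costs at least as much as the half turn.\<close>
  define d where "d i = exp (sqrt k * pi * real (idx i))" for i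
  have gap: "sqrt k * pi \<le> \<bar>ln (d i) - ln (d j)\<bar>" if "i \<noteq> j" for i j
  proof -
    have "idx i \<noteq> idx j" using idx that by (simp add: inj_eq)
    hence "1 \<le> \<bar>real (idx i) - real (idx j)\<bar>" by linarith
    hence "sqrt k * pi * 1 \<le> sqrt k * pi * \<bar>real (idx i) - real (idx j)\<bar>"
      using assms(1) by (intro mult_left_mono) auto
    also have "\<dots> = \<bar>ln (d i) - ln (d j)\<bar>"
      using assms(1) by (simp add: d_def right_diff_distrib[symmetric] abs_mult)
    finally show ?thesis by simp
  qed
  have "inj d"
    using idx assms(1) by (auto simp: inj_def d_def)
  define D where "D = diag_matrix d"
  have D: "D \<in> Diag_plus" unfolding Diag_plus_iff D_def by (rule exI[of _ d]) (simp add: d_def)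
  have I: "(mat 1 :: real^'n^'n) \<in> SO" by (simp add: SO_iff orthogonal_matrix_id)
  have mem: "(mat 1, D) \<in> M_space" "(R, D) \<in> M_space" by (simp_all add: M_space_def I R D)
  define X Y where "X = F_map (mat 1, D)" and "Y = F_map (R, D)"
  have XY: "X \<in> Sym_plus" "Y \<in> Sym_plus"
    unfolding X_def Y_def by (intro F_map_in_Sym_plus mem)+
  have XD: "X = diag_matrix d" by (simp add: X_def F_map_def D_def)

  define \<gamma> where "\<gamma> \<omega> t = (plane_rotation x y (\<omega> * t), D)" for \<omega> t
  have ends: "\<gamma> \<omega> 0 = (mat 1, D)" for \<omega> by (simp add: \<gamma>_def)
  have ends1: "\<gamma> \<omega> 1 = (R, D)" if "\<bar>\<omega>\<bar> = pi" for \<omega>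
    using that by (auto simp: \<gamma>_def R_def half_turn_def plane_rotation_def abs_eq_iff')
  have fib: "(mat 1, D) \<in> fibre X" "(R, D) \<in> fibre Y"
    using mem by (simp_all add: fibre_def X_def Y_def)
  have len: "curve_length (g_M k) (\<gamma> \<omega>) = sqrt k * pi" if "\<bar>\<omega>\<bar> = pi" for \<omega>
    using plane_rotation_length[OF assms(1) on D, of \<omega>] that unfolding \<gamma>_def by simp
  have adm: "admissible_curve k (\<gamma> pi)"
    using plane_rotation_admissible[OF assms(1) on D, of pi] unfolding \<gamma>_def .
  have dSR: "d_SR k X Y = sqrt k * pi"
  proof (rule d_SR_eqI[OF assms(1) adm])
    show "sqrt k * pi \<le> curve_length (g_M k) \<delta>"
      if "admissible_curve k \<delta>" "\<delta> 0 \<in> fibre X" "\<delta> 1 \<in> fibre Y" for \<delta>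
      by (rule length_ge_pi_between_fibres[OF assms(1) that(1) AB(1) A(2) AB(2) \<open>inj d\<close> gap])
         (use that(2,3) in \<open>auto simp: XD Y_def R_def x_def y_def D_def\<close>)
  qed (simp_all add: ends ends1 fib len)
  have min: "F_minimal_geodesic k X Y (\<gamma> \<omega>)" if "\<bar>\<omega>\<bar> = pi" for \<omega>
  proof -
    have "riemannian_geodesic M_space (g_M k) (\<gamma> \<omega>)"
      using plane_rotation_geodesic[OF assms(1) on D, of \<omega>] unfolding \<gamma>_def .
    thus ?thesis
      using fib by (simp add: F_minimal_geodesic_def ends ends1[OF that] len[OF that] dSR)
  qed

  have "R \<noteq> mat 1"
  proof
    assume "R = mat 1"
    hence "half_turn x y *v x = x" by (simp add: R_def)
    thus False using on by (auto simp: half_turn_vector orthonormal_pair_def inner_commute)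
  qed
  hence "geodesically_antipodal (mat 1, D) (R, D)"
    using R RR by (simp add: geodesically_antipodal_def involution_def matrix_inv_orthogonal SO_iff R_def)
  moreover have "minimal_pair k (mat 1, D) (R, D)"
    unfolding minimal_pair_def using XY min[of pi] ends ends1[of pi] by auto
  moreover have "distinct_diagonal D" using \<open>inj d\<close> by (simp add: distinct_diagonal_def D_def)
  ultimately have first: "\<exists>U D V \<Lambda> :: real^'n^'n.
            (U, D) \<in> M_space \<and> (V, \<Lambda>) \<in> M_space \<and>
            geodesically_antipodal (U, D) (V, \<Lambda>) \<and>
            minimal_pair k (U, D) (V, \<Lambda>) \<and>
            distinct_diagonal D \<and> distinct_diagonal \<Lambda>"
    using mem by blast

  \<comment> \<open>Two coordinates in \<open>A\<close> give an off-diagonal entry \<open>1/6\<close> of the projection to the plane.\<close>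
  have "sr_curve (\<gamma> pi) \<noteq> sr_curve (\<gamma> (- pi))"
  proof
    assume "sr_curve (\<gamma> pi) = sr_curve (\<gamma> (- pi))"
    hence "sr_curve (\<gamma> pi) (1 / 2) = sr_curve (\<gamma> (- pi)) (1 / 2)" by simp
    hence comm: "plane_proj x y ** D = D ** plane_proj x y"
      by (intro quarter_turns_conjugate_eqD[OF on]) (simp_all add: D_def sr_curve_def \<gamma>_def)
    obtain a b where ab: "a \<in> A" "b \<in> A" "a \<noteq> b"
      using A(2) card_le_Suc0_iff_eq[of A] by auto
    have "a \<notin> B" using ab AB(1) by auto
    hence "plane_proj x y $ a $ b \<noteq> 0"
      using ab A(2) by (simp add: plane_proj_def outer_def x_def y_def unit_indicator_def indicator_vec_def)
    moreover have "(plane_proj x y ** D) $ a $ b = (D ** plane_proj x y) $ a $ b"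
      by (simp add: comm)
    ultimately have "d a = d b"
      by (simp add: D_def mult_diag_matrix_nth diag_matrix_mult_nth)
    thus False using \<open>inj d\<close> ab(3) by (simp add: inj_eq)
  qed
  hence "type_II_nonunique k X Y"
    unfolding type_II_nonunique_def using min[of pi] min[of "- pi"] ends ends1[of pi] ends1[of "- pi"]
    by (intro exI[of _ "\<gamma> pi"] exI[of _ "\<gamma> (- pi)"]) simp
  moreover have "card (eigenvalues X) = CARD('n)" "card (eigenvalues Y) = CARD('n)"
    using \<open>inj d\<close> by (simp_all add: X_def Y_def D_def eigenvalues_F_map I R card_image)
  ultimately show ?thesis using first XY by blast
qed

end
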